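(* Let $\mathrm{Der}\,\Omega(M)=D\oplus D^\bot$, $G=G^D\oplus G^{D^\bot}$, $U$, the semi-symmetric metric connection $\nabla$ with curvature $R$, and $\widetilde B$, $\widetilde\nabla^D$, $\nabla^\bot$ be as in the context. Then for all homogeneous $X,Y,Z\in D$ (Codazzi equation with respect to $\nabla$): \begin{align*} (R(X,Y)Z)^{D^\bot}={}&(\nabla^\bot_X\widetilde B)(Y,Z)-(-1)^{|X||Y|}(\nabla^\bot_Y\widetilde B)(X,Z)-G(X,U)\widetilde B(Y,Z)\\ &+(-1)^{|X||Y|}G(Y,U)\widetilde B(X,Z)-\pi^{D^\bot}[[X,Y]^{D^\bot},Z]\\ &-(-1)^{(|X|+|Y|)|Z|}\nabla^\bot_Z([X,Y]^{D^\bot})-[X,Y]^{D^\bot}\cdot G(Z,U), \end{align*} where $(\nabla^\bot_X\widetilde B)(Y,Z)=\nabla^\bot_X(\widetilde B(Y,Z))-\widetilde B(\widetilde\nabla^D_XY,Z)-(-1)^{|X||Y|}\widetilde B(Y,\widetilde\nabla^D_XZ)$.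
   Context: Let $M$ be a smooth manifold, $\Omega(M)$ its $\mathbb Z_2$-graded commutative algebra of differential forms, and $\mathrm{Der}\,\Omega(M)$ the graded left $\Omega(M)$-module of graded derivations, with graded commutator $[X,Y]=XY-(-1)^{|X||Y|}YX$ and right multiplication $X\cdot\alpha=(-1)^{|\alpha||X|}\alpha X$. A graded metric is a map $G:(X,Y)\mapsto G(X,Y)\in\Omega(M)$ of some parity $|G|$ ($|G(X,Y)|=|X|+|Y|+|G|$ mod 2) that is biadditive, satisfies $G(X,Y)=(-1)^{|X||Y|}G(Y,X)$, $G(\alpha X,Y)=\alpha G(X,Y)=(-1)^{|X||\alpha|}G(X,\alpha Y)$, and is non-degenerate. A graded connection is a degree preserving biadditive map $\nabla$ on $\mathrm{Der}\,\Omega(M)$ with $\nabla_{\alpha X}Y=\alpha\nabla_XY$, $\nabla_X(\alpha Y)=X(\alpha)Y+(-1)^{|X||\alpha|}\alpha\nabla_XY$; its curvature is $R(X,Y)Z=\nabla_X\nabla_YZ-(-1)^{|X||Y|}\nabla_Y\nabla_XZ-\nabla_{[X,Y]}Z$. $\nabla^L$ is the graded Levi-Civita connection of $G$: the unique torsion-free ($\nabla^L_XY-(-1)^{|X||Y|}\nabla^L_YX=[X,Y]$) graded connection with $X\,G(Y,Z)=G(\nabla^L_XY,Z)+(-1)^{|X||Y|}G(Y,\nabla^L_XZ)$. Fix $U\in\mathrm{Der}\,\Omega(M)$ homogeneous with $|U|+|G|=0$ mod 2; the semi-symmetric metric connection is $\nabla_XY=\nabla^L_XY+X\cdot G(Y,U)-G(X,Y)U$.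 $D,D^\bot\subseteq\mathrm{Der}\,\Omega(M)$ are graded submodules with $\mathrm{Der}\,\Omega(M)=D\oplus D^\bot$ and $G=G^D\oplus G^{D^\bot}$, with $G^D$, $G^{D^\bot}$ metrics on $D$, $D^\bot$ (so $D$ and $D^\bot$ are $G$-orthogonal); $\pi^D,\pi^{D^\bot}$ are the even projections, and superscripts $D$, $D^\bot$ on an element denote its projections. For $X,Y\in D$: $\widetilde\nabla^D_XY=\pi^D\nabla_XY$ and $\widetilde B(X,Y)=\pi^{D^\bot}\nabla_XY$. For $X\in D$, $\xi\in D^\bot$: $\nabla^\bot_X\xi=\pi^{D^\bot}\nabla^L_X\xi=\pi^{D^\bot}\nabla_X\xi$. *)

theory Defs
  imports "HOL-Analysis.Analysis" "HOL-Library.Function_Algebras" "HOL-Library.Z2"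
begin

section \<open>Smooth manifolds and their differential forms\<close>

text \<open>\<open>R\<^sup>n\<close> is \<^term>\<open>Euclidean_space n\<close>, whose points are the \<^typ>\<open>nat \<Rightarrow> real\<close> that vanish
  from index \<open>n\<close> on. This keeps \<open>n\<close> an ordinary number and includes \<open>n = 0\<close>.\<close>

definition pderiv_at :: "nat \<Rightarrow> ((nat \<Rightarrow> real) \<Rightarrow> real) \<Rightarrow> (nat \<Rightarrow> real) \<Rightarrow> real" where
  "pderiv_at i f x = deriv (\<lambda>t. f (x(i := t))) (x i)"

primrec Ck_on :: "nat \<Rightarrow> nat \<Rightarrow> (nat \<Rightarrow> real) set \<Rightarrow> ((nat \<Rightarrow> real) \<Rightarrow> real) \<Rightarrow> bool" where
  "Ck_on n 0 V f \<longleftrightarrow> continuous_map (subtopology (Euclidean_space n) V) euclidean f"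
| "Ck_on n (Suc k) V f \<longleftrightarrow>
     continuous_map (subtopology (Euclidean_space n) V) euclidean f \<and>
     (\<forall>i<n. (\<forall>x\<in>V. (\<lambda>t. f (x(i := t))) differentiable at (x i)) \<and>
             Ck_on n k V (pderiv_at i f))"

text \<open>Only used for \<open>V\<close> open in \<^term>\<open>Euclidean_space n\<close>.\<close>

definition smooth_on :: "nat \<Rightarrow> (nat \<Rightarrow> real) set \<Rightarrow> ((nat \<Rightarrow> real) \<Rightarrow> real) \<Rightarrow> bool" where
  "smooth_on n V f \<longleftrightarrow> (\<forall>k. Ck_on n k V f)"

text \<open>The underlying set of the manifold is the whole type \<open>'m\<close>; that it is Hausdorff and second
  countable is its sort constraint. The atlas need not be maximal.\<close>

record 'm manifold =
  mdim :: nat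
  atlas :: "('m set \<times> ('m \<Rightarrow> nat \<Rightarrow> real)) set"

definition smooth_manifold :: "'m::{t2_space,second_countable_topology} manifold \<Rightarrow> bool" where
  "smooth_manifold M \<longleftrightarrow>
     (\<forall>(W, \<phi>)\<in>atlas M.
        open W \<and> openin (Euclidean_space (mdim M)) (\<phi> ` W) \<and>
        homeomorphic_map (top_of_set W) (subtopology (Euclidean_space (mdim M)) (\<phi> ` W)) \<phi>) \<and>
     (\<Union>(W, \<phi>)\<in>atlas M. W) = UNIV \<and>
     (\<forall>(W, \<phi>)\<in>atlas M. \<forall>(W', \<phi>')\<in>atlas M. \<forall>i<mdim M.
        smooth_on (mdim M) (\<phi> ` (W \<inter> W')) (\<lambda>x. \<phi>' (inv_into W \<phi> x) i))"

definition smooth_funs :: "'m manifold \<Rightarrow> ('m \<Rightarrow> real) set" where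
  "smooth_funs M =
     {f. \<forall>(W, \<phi>)\<in>atlas M. smooth_on (mdim M) (\<phi> ` W) (\<lambda>x. f (inv_into W \<phi> x))}"

text \<open>A tangent vector at \<open>p\<close> is a derivation at \<open>p\<close> of the algebra of smooth functions. It is set to
  \<open>0\<close> on all other functions, so that equality of tangent vectors is equality of functions.\<close>

type_synonym 'm tvec = "('m \<Rightarrow> real) \<Rightarrow> real"

definition tangent_space :: "'m manifold \<Rightarrow> 'm \<Rightarrow> 'm tvec set" where
  "tangent_space M p =
     {v. (\<forall>f\<in>smooth_funs M. \<forall>h\<in>smooth_funs M. \<forall>c d.
            v (\<lambda>q. c * f q + d * h q) = c * v f + d * v h) \<and>
         (\<forall>f\<in>smooth_funs M. \<forall>h\<in>smooth_funs M.
            v (\<lambda>q. f q * h q) = f p * v h + h p * v f) \<and>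
         (\<forall>f. f \<notin> smooth_funs M \<longrightarrow> v f = 0)}"

definition vector_fields :: "'m manifold \<Rightarrow> ('m \<Rightarrow> 'm tvec) set" where
  "vector_fields M =
     {V. (\<forall>p. V p \<in> tangent_space M p) \<and> (\<forall>f\<in>smooth_funs M. (\<lambda>p. V p f) \<in> smooth_funs M)}"

text \<open>A (possibly inhomogeneous) form \<open>\<omega>\<close> is encoded by all its components together: the value of
  its \<open>k\<close>-form component at \<open>p\<close> on \<open>v\<^sub>1, \<dots>, v\<^sub>k\<close> is \<open>\<omega> p [v\<^sub>1, \<dots>, v\<^sub>k]\<close>. Values on lists that are not
  lists of tangent vectors at \<open>p\<close> are \<open>0\<close>. The bound \<open>N\<close> below says that only finitely many components
  are nonzero.\<close>

type_synonym 'm form = "'m \<Rightarrow> 'm tvec list \<Rightarrow> real"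

definition alternating_multilinear :: "'m tvec set \<Rightarrow> ('m tvec list \<Rightarrow> real) \<Rightarrow> bool" where
  "alternating_multilinear T f \<longleftrightarrow>
     (\<forall>vs i u w c d. set vs \<subseteq> T \<and> i < length vs \<and> u \<in> T \<and> w \<in> T \<longrightarrow>
        f (vs[i := (\<lambda>h. c * u h + d * w h)]) = c * f (vs[i := u]) + d * f (vs[i := w])) \<and>
     (\<forall>vs. \<not> distinct vs \<longrightarrow> f vs = 0) \<and>
     (\<forall>vs. \<not> set vs \<subseteq> T \<longrightarrow> f vs = 0)"

definition forms :: "'m manifold \<Rightarrow> 'm form set" where
  "forms M =
     {\<omega>. (\<forall>p. alternating_multilinear (tangent_space M p) (\<omega> p)) \<and>
         (\<forall>Vs. set Vs \<subseteq> vector_fields M \<longrightarrow> (\<lambda>p. \<omega> p (map (\<lambda>V. V p) Vs)) \<in> smooth_funs M) \<and>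
         (\<exists>N. \<forall>p vs. length vs > N \<longrightarrow> \<omega> p vs = 0)}"

definition forms_hom :: "'m manifold \<Rightarrow> bit \<Rightarrow> 'm form set" where
  "forms_hom M c = {\<omega> \<in> forms M. \<forall>p vs. (of_nat (length vs) :: bit) \<noteq> c \<longrightarrow> \<omega> p vs = 0}"

text \<open>\<open>(\<alpha> \<and> \<beta>)(v\<^sub>1, \<dots>, v\<^sub>n) = \<Sum> sgn(\<sigma>) \<alpha>(v\<^sub>\<sigma>\<^sub>1, \<dots>, v\<^sub>\<sigma>\<^sub>k) \<beta>(v\<^sub>\<sigma>\<^sub>(\<^sub>k\<^sub>+\<^sub>1\<^sub>), \<dots>, v\<^sub>\<sigma>\<^sub>n)\<close>, the sum being over \<open>k\<close> and over
  \<open>(k, n-k)\<close>-shuffles \<open>\<sigma>\<close>. A shuffle is given by the set \<open>S\<close> of positions that go to \<open>\<alpha>\<close>, and its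
  inversions are the pairs \<open>j < i\<close> with \<open>i \<in> S\<close>, \<open>j \<notin> S\<close>.\<close>

definition wedge :: "'m form \<Rightarrow> 'm form \<Rightarrow> 'm form" where
  "wedge \<alpha> \<beta> = (\<lambda>p vs. \<Sum>S\<in>Pow {..<length vs}.
     (-1) ^ card {(i, j). i \<in> S \<and> j \<in> {..<length vs} - S \<and> j < i} *
     \<alpha> p (nths vs S) * \<beta> p (nths vs (- S)))"


section \<open>Graded derivations\<close>

text \<open>\<open>(-1)\<^sup>e x\<close>.\<close>

definition msign :: "bit \<Rightarrow> 'x::ab_group_add \<Rightarrow> 'x" where
  "msign e x = (if e = 0 then x else - x)"

text \<open>As with tangent vectors, a derivation is set to \<open>0\<close> off \<open>\<Omega>(M)\<close>.\<close>

type_synonym 'm der = "'m form \<Rightarrow> 'm form"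

definition Der_hom :: "'m manifold \<Rightarrow> bit \<Rightarrow> 'm der set" where
  "Der_hom M a =
     {X. (\<forall>b. \<forall>\<alpha>\<in>forms_hom M b. X \<alpha> \<in> forms_hom M (a + b)) \<and>
         (\<forall>\<alpha>\<in>forms M. \<forall>\<beta>\<in>forms M. \<forall>c d.
            X (\<lambda>p vs. c * \<alpha> p vs + d * \<beta> p vs) = (\<lambda>p vs. c * X \<alpha> p vs + d * X \<beta> p vs)) \<and>
         (\<forall>b. \<forall>\<alpha>\<in>forms_hom M b. \<forall>\<beta>\<in>forms M.
            X (wedge \<alpha> \<beta>) = wedge (X \<alpha>) \<beta> + msign (a * b) (wedge \<alpha> (X \<beta>))) \<and>
         (\<forall>\<alpha>. \<alpha> \<notin> forms M \<longrightarrow> X \<alpha> = 0)}"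

definition Der :: "'m manifold \<Rightarrow> 'm der set" where
  "Der M = {X + Y | X Y. X \<in> Der_hom M 0 \<and> Y \<in> Der_hom M 1}"

definition smul :: "'m form \<Rightarrow> 'm der \<Rightarrow> 'm der" where
  "smul \<alpha> X = (\<lambda>\<omega>. wedge \<alpha> (X \<omega>))"

text \<open>The projection onto the first summand of a direct sum \<open>A \<oplus> B\<close>.\<close>

definition proj :: "'x::ab_group_add set \<Rightarrow> 'x set \<Rightarrow> 'x \<Rightarrow> 'x" where
  "proj A B x = (THE y. y \<in> A \<and> x - y \<in> B)"

text \<open>Formulas with signs are given on homogeneous arguments of parities \<open>a\<close>, \<open>b\<close> and extended
  biadditively: \<open>hom_part A a x\<close> is the component of \<open>x\<close> in \<open>A a\<close>, where \<open>x\<close> lies in \<open>A 0 \<oplus> A 1\<close>.\<close>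

definition hom_part :: "(bit \<Rightarrow> 'x::ab_group_add set) \<Rightarrow> bit \<Rightarrow> 'x \<Rightarrow> 'x" where
  "hom_part A a x = proj (A a) (A (a + 1)) x"

definition biextend ::
  "(bit \<Rightarrow> 'x::ab_group_add set) \<Rightarrow> (bit \<Rightarrow> 'y::ab_group_add set) \<Rightarrow>
   (bit \<Rightarrow> bit \<Rightarrow> 'x \<Rightarrow> 'y \<Rightarrow> 'z::ab_group_add) \<Rightarrow> 'x \<Rightarrow> 'y \<Rightarrow> 'z" where
  "biextend A B F x y = (\<Sum>a\<in>{0, 1}. \<Sum>b\<in>{0, 1}. F a b (hom_part A a x) (hom_part B b y))"

definition bracket :: "'m manifold \<Rightarrow> 'm der \<Rightarrow> 'm der \<Rightarrow> 'm der" where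
  "bracket M = biextend (Der_hom M) (Der_hom M) (\<lambda>a b X Y. X \<circ> Y - msign (a * b) (Y \<circ> X))"

definition rmul :: "'m manifold \<Rightarrow> 'm der \<Rightarrow> 'm form \<Rightarrow> 'm der" where
  "rmul M = biextend (Der_hom M) (forms_hom M) (\<lambda>a b X \<alpha>. msign (b * a) (smul \<alpha> X))"

definition graded_submodule :: "'m manifold \<Rightarrow> 'm der set \<Rightarrow> bool" where
  "graded_submodule M S \<longleftrightarrow>
     S \<subseteq> Der M \<and> 0 \<in> S \<and> (\<forall>X\<in>S. \<forall>Y\<in>S. X + Y \<in> S) \<and>
     (\<forall>\<alpha>\<in>forms M. \<forall>X\<in>S. smul \<alpha> X \<in> S) \<and>
     (\<forall>X\<in>S. \<exists>Y\<in>S \<inter> Der_hom M 0. \<exists>Z\<in>S \<inter> Der_hom M 1. X = Y + Z)"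

definition direct_sum :: "'x::ab_group_add set \<Rightarrow> 'x set \<Rightarrow> 'x set \<Rightarrow> bool" where
  "direct_sum E A B \<longleftrightarrow> E = {x + y | x y. x \<in> A \<and> y \<in> B} \<and> A \<inter> B = {0}"

definition biadditive_on :: "'x::plus set \<Rightarrow> ('x \<Rightarrow> 'x \<Rightarrow> 'y::plus) \<Rightarrow> bool" where
  "biadditive_on S F \<longleftrightarrow>
     (\<forall>X\<in>S. \<forall>Y\<in>S. \<forall>Z\<in>S. F (X + Y) Z = F X Z + F Y Z \<and> F X (Y + Z) = F X Y + F X Z)"


section \<open>Graded metrics and connections\<close>

text \<open>A graded metric of parity \<open>g\<close> on a graded submodule \<open>S\<close> of \<^term>\<open>Der M\<close>. Non-degeneracy is
  injectivity of \<open>X \<mapsto> G(X, \<cdot>)\<close>; bijectivity onto the dual module is not demanded.\<close>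

definition graded_metric ::
  "'m manifold \<Rightarrow> 'm der set \<Rightarrow> bit \<Rightarrow> ('m der \<Rightarrow> 'm der \<Rightarrow> 'm form) \<Rightarrow> bool" where
  "graded_metric M S g G \<longleftrightarrow>
     (\<forall>a b. \<forall>X\<in>S \<inter> Der_hom M a. \<forall>Y\<in>S \<inter> Der_hom M b.
        G X Y \<in> forms_hom M (a + b + g) \<and> G X Y = msign (a * b) (G Y X)) \<and>
     biadditive_on S G \<and>
     (\<forall>a b. \<forall>\<alpha>\<in>forms_hom M b. \<forall>X\<in>S \<inter> Der_hom M a. \<forall>Y\<in>S.
        G (smul \<alpha> X) Y = wedge \<alpha> (G X Y) \<and>
        wedge \<alpha> (G X Y) = msign (a * b) (G X (smul \<alpha> Y))) \<and>
     (\<forall>X\<in>S. (\<forall>Y\<in>S. G X Y = 0) \<longrightarrow> X = 0)"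

definition graded_connection :: "'m manifold \<Rightarrow> ('m der \<Rightarrow> 'm der \<Rightarrow> 'm der) \<Rightarrow> bool" where
  "graded_connection M nab \<longleftrightarrow>
     (\<forall>a b. \<forall>X\<in>Der_hom M a. \<forall>Y\<in>Der_hom M b. nab X Y \<in> Der_hom M (a + b)) \<and>
     biadditive_on (Der M) nab \<and>
     (\<forall>\<alpha>\<in>forms M. \<forall>X\<in>Der M. \<forall>Y\<in>Der M. nab (smul \<alpha> X) Y = smul \<alpha> (nab X Y)) \<and>
     (\<forall>a b. \<forall>X\<in>Der_hom M a. \<forall>\<alpha>\<in>forms_hom M b. \<forall>Y\<in>Der M.
        nab X (smul \<alpha> Y) = smul (X \<alpha>) Y + msign (a * b) (smul \<alpha> (nab X Y)))"

text \<open>By the Koszul formula these conditions determine the connection on \<^term>\<open>Der M\<close>, so its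
  uniqueness is not repeated as a condition.\<close>

definition levi_civita ::
  "'m manifold \<Rightarrow> ('m der \<Rightarrow> 'm der \<Rightarrow> 'm form) \<Rightarrow> ('m der \<Rightarrow> 'm der \<Rightarrow> 'm der) \<Rightarrow> bool" where
  "levi_civita M G nab \<longleftrightarrow>
     graded_connection M nab \<and>
     (\<forall>a b. \<forall>X\<in>Der_hom M a. \<forall>Y\<in>Der_hom M b.
        nab X Y - msign (a * b) (nab Y X) = bracket M X Y) \<and>
     (\<forall>a b. \<forall>X\<in>Der_hom M a. \<forall>Y\<in>Der_hom M b. \<forall>Z\<in>Der M.
        X (G Y Z) = G (nab X Y) Z + msign (a * b) (G Y (nab X Z)))"

definition semi_symmetric ::
  "'m manifold \<Rightarrow> ('m der \<Rightarrow> 'm der \<Rightarrow> 'm form) \<Rightarrow> 'm der \<Rightarrow> ('m der \<Rightarrow> 'm der \<Rightarrow> 'm der) \<Rightarrow>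
   'm der \<Rightarrow> 'm der \<Rightarrow> 'm der" where
  "semi_symmetric M G U nabL X Y = nabL X Y + rmul M X (G Y U) - smul (G X Y) U"

definition curvature ::
  "'m manifold \<Rightarrow> ('m der \<Rightarrow> 'm der \<Rightarrow> 'm der) \<Rightarrow> 'm der \<Rightarrow> 'm der \<Rightarrow> 'm der \<Rightarrow> 'm der" where
  "curvature M nab X Y Z =
     biextend (Der_hom M) (Der_hom M)
       (\<lambda>a b X Y. nab X (nab Y Z) - msign (a * b) (nab Y (nab X Z))) X Y
     - nab (bracket M X Y) Z"

text \<open>\<open>(\<nabla>\<^sup>\<bottom>\<^sub>X B)(Y, Z)\<close>, for connections \<open>nabD\<close> on \<open>D\<close> and \<open>nabP\<close> on \<open>D\<^sup>\<bottom>\<close>.\<close>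

definition cov_deriv_B ::
  "'m manifold \<Rightarrow> ('m der \<Rightarrow> 'm der \<Rightarrow> 'm der) \<Rightarrow> ('m der \<Rightarrow> 'm der \<Rightarrow> 'm der) \<Rightarrow>
   ('m der \<Rightarrow> 'm der \<Rightarrow> 'm der) \<Rightarrow> 'm der \<Rightarrow> 'm der \<Rightarrow> 'm der \<Rightarrow> 'm der" where
  "cov_deriv_B M nabD nabP B X Y Z =
     biextend (Der_hom M) (Der_hom M)
       (\<lambda>a b X Y. nabP X (B Y Z) - B (nabD X Y) Z - msign (a * b) (B Y (nabD X Z))) X Y"

end

theory Submission
  imports Defs
begin

text \<open>Split \<open>\<nabla>\<^sub>Y Z = \<nabla>\<^sup>D\<^sub>Y Z + B(Y, Z)\<close> inside \<open>\<nabla>\<^sub>X \<nabla>\<^sub>Y Z\<close>. On \<open>D\<^sup>\<bottom>\<close> the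
  correction terms of \<open>\<nabla>\<close> along \<open>X \<in> D\<close> have no \<open>D\<^sup>\<bottom>\<close> component, so
  \<open>(\<nabla>\<^sub>X \<nabla>\<^sub>Y Z)\<^sup>\<bottom> = B(X, \<nabla>\<^sup>D\<^sub>Y Z) + \<nabla>\<^sup>\<bottom>\<^sub>X (B(Y, Z))\<close>, and the curvature differs from the
  antisymmetrised covariant derivative of \<open>B\<close> by \<open>B(\<nabla>\<^sup>D\<^sub>X Y \<mp> \<nabla>\<^sup>D\<^sub>Y X, Z)\<close>
  and \<open>(\<nabla>\<^bsub>[X, Y]\<^esub> Z)\<^sup>\<bottom>\<close>. The former is evaluated with the torsion of \<open>\<nabla>\<close>; in the
  latter, the part along \<open>[X, Y]\<^sup>\<bottom>\<close> is evaluated with torsion-freeness of \<open>\<nabla>\<^sup>L\<close>.\<close>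

section \<open>Associativity of the wedge product\<close>

text \<open>In the sum over shuffles, either position \<open>0\<close> goes to the left factor, and then it adds no
  inversions, or it goes to the right one and adds as many as the left factor has arguments. The
  resulting recursion reduces associativity to an induction on the list of arguments.\<close>

primrec shuffle_prod :: "'v list \<Rightarrow> ('v list \<Rightarrow> real) \<Rightarrow> ('v list \<Rightarrow> real) \<Rightarrow> real" where
  "shuffle_prod [] f h = f [] * h []"
| "shuffle_prod (v # vs) f h = shuffle_prod vs (\<lambda>ws. f (v # ws)) h
     + shuffle_prod vs (\<lambda>ws. (-1) ^ length ws * f ws) (\<lambda>ws. h (v # ws))"

lemma sum_shuffles_eq_shuffle_prod:
  "(\<Sum>S\<in>Pow {..<length vs}.
     (-1) ^ card {(i, j). i \<in> S \<and> j \<in> {..<length vs} - S \<and> j < i} *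
     f (nths vs S) * h (nths vs (- S))) = shuffle_prod vs f h"
proof (induction vs arbitrary: f h)
  case Nil
  then show ?case by simp
next
  case (Cons v vs)
  define n where "n = length vs"
  define inv where "inv m S = {(i, j). i \<in> S \<and> j \<in> {..<m} - S \<and> j < i}" for m :: nat and S
  define t where "t S = (-1) ^ card (inv (Suc n) S) * f (nths (v # vs) S) * h (nths (v # vs) (- S))"
    for S
  have lessThan: "{..<Suc n} = insert 0 (Suc ` {..<n})"
    by (rule lessThan_Suc_eq_insert_0)
  have inj1: "inj_on ((`) Suc) A" and inj2: "inj_on (\<lambda>S. insert 0 (Suc ` S)) A" for A
    by (auto simp: inj_on_def inj_image_eq_iff insert_eq_iff image_iff)
  have inv1: "inv (Suc n) (insert 0 (Suc ` S)) = map_prod Suc Suc ` inv n S" for S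
    by (auto simp: inv_def lessThan image_iff)
  have inv2: "inv (Suc n) (Suc ` S) = map_prod Suc Suc ` inv n S \<union> (\<lambda>i. (Suc i, 0)) ` S" for S
    by (auto simp: inv_def lessThan image_iff)
  have card1: "card (inv (Suc n) (insert 0 (Suc ` S))) = card (inv n S)" for S
    unfolding inv1 by (rule card_image) (auto simp: inj_on_def)
  have card2: "card (inv (Suc n) (Suc ` S)) = card (inv n S) + length (nths vs S)"
    if S: "S \<subseteq> {..<n}" for S
  proof -
    have fin: "finite S" using S finite_subset by blast
    have "finite (inv n S)"
      by (rule finite_subset[of _ "S \<times> {..<n}"]) (auto simp: inv_def fin)
    moreover have "card (map_prod Suc Suc ` inv n S) = card (inv n S)"
      by (rule card_image) (auto simp: inj_on_def)
    moreover have "card ((\<lambda>i. (Suc i, 0::nat)) ` S) = card S"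
      by (rule card_image) (auto simp: inj_on_def)
    \<comment> \<open>\<open>length_nths\<close> counts the positions below \<open>length vs\<close>
      that lie in \<open>S\<close>. Since \<open>S\<close> has no others, the number of arguments of
      the left factor is \<open>card S\<close>, the number of new inversions
      \<open>(Suc i, 0)\<close>.\<close>
    moreover have "{i. i < length vs \<and> i \<in> S} = S"
      using S by (auto simp: n_def)
    ultimately show ?thesis
      unfolding inv2 by (subst card_Un_disjoint) (auto simp: fin length_nths)
  qed
  \<comment> \<open>The subsets of \<open>{..<Suc n}\<close> are split by whether they contain
    \<open>0\<close>; the subsets of \<open>{..<n}\<close> index either family.\<close>
  have "(\<Sum>S\<in>Pow {..<Suc n}. t S) =
      (\<Sum>S\<in>(`) Suc ` Pow {..<n}. t S) + (\<Sum>S\<in>(\<lambda>S. insert 0 (Suc ` S)) ` Pow {..<n}. t S)"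
  proof (subst sum.union_disjoint[symmetric])
    have "Pow {..<Suc n} = (`) Suc ` Pow {..<n} \<union> (\<lambda>S. insert 0 (Suc ` S)) ` Pow {..<n}"
      unfolding lessThan Pow_insert by (simp add: image_Pow_surj[OF refl, symmetric] image_image)
    then show "(\<Sum>S\<in>Pow {..<Suc n}. t S) =
      sum t ((`) Suc ` Pow {..<n} \<union> (\<lambda>S. insert 0 (Suc ` S)) ` Pow {..<n})" by simp
  qed auto
  also have "(\<Sum>S\<in>(`) Suc ` Pow {..<n}. t S) = (\<Sum>S\<in>Pow {..<n}. t (Suc ` S))"
    by (subst sum.reindex[OF inj1]) simp
  \<comment> \<open>The extra sign depends only on the length of the left argument list, so it can
    be absorbed into \<open>f\<close>; this is why the induction is over arbitrary \<open>f\<close>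
    and \<open>h\<close>.\<close>
  also have "\<dots> = (\<Sum>S\<in>Pow {..<n}. (-1) ^ card (inv n S) *
      ((-1) ^ length (nths vs S) * f (nths vs S)) * h (v # nths vs (- S)))"
  proof (rule sum.cong[OF refl])
    fix S assume "S \<in> Pow {..<n}"
    moreover have "{j. Suc j \<in> Suc ` S} = S" "{j. Suc j \<notin> Suc ` S} = - S" by auto
    ultimately show "t (Suc ` S) = (-1) ^ card (inv n S) *
      ((-1) ^ length (nths vs S) * f (nths vs S)) * h (v # nths vs (- S))"
      by (simp add: t_def card2 nths_Cons power_add)
  qed
  also have "\<dots> = shuffle_prod vs (\<lambda>ws. (-1) ^ length ws * f ws) (\<lambda>ws. h (v # ws))"
    unfolding inv_def n_def by (rule Cons.IH)
  also have "(\<Sum>S\<in>(\<lambda>S. insert 0 (Suc ` S)) ` Pow {..<n}. t S) =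
      (\<Sum>S\<in>Pow {..<n}. t (insert 0 (Suc ` S)))"
    by (subst sum.reindex[OF inj2]) simp
  also have "\<dots> = (\<Sum>S\<in>Pow {..<n}. (-1) ^ card (inv n S) *
      f (v # nths vs S) * h (nths vs (- S)))"
  proof (rule sum.cong[OF refl])
    fix S
    have "{j. Suc j \<in> Suc ` S} = S" "{j. Suc j \<notin> Suc ` S} = - S" by auto
    then show "t (insert 0 (Suc ` S)) =
      (-1) ^ card (inv n S) * f (v # nths vs S) * h (nths vs (- S))"
      by (simp add: t_def card1 nths_Cons)
  qed
  also have "\<dots> = shuffle_prod vs (\<lambda>ws. f (v # ws)) h"
    unfolding inv_def n_def by (rule Cons.IH)
  finally show ?case
    by (simp add: t_def inv_def n_def)
qed

lemma wedge_eq_shuffle_prod: "wedge \<alpha> \<beta> p vs = shuffle_prod vs (\<alpha> p) (\<beta> p)"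
  unfolding wedge_def by (rule sum_shuffles_eq_shuffle_prod)

lemma shuffle_prod_add_left:
  "shuffle_prod vs (\<lambda>ws. f ws + f' ws) h = shuffle_prod vs f h + shuffle_prod vs f' h"
  by (induction vs arbitrary: f f' h) (simp_all add: algebra_simps)

lemma shuffle_prod_add_right:
  "shuffle_prod vs f (\<lambda>ws. h ws + h' ws) = shuffle_prod vs f h + shuffle_prod vs f h'"
  by (induction vs arbitrary: f h h') (simp_all add: algebra_simps)

lemma shuffle_prod_scale_left:
  "shuffle_prod vs (\<lambda>ws. r * f ws) h = r * shuffle_prod vs f h"
  by (induction vs arbitrary: f h) (simp_all add: distrib_left mult.left_commute)

lemma shuffle_prod_scale_right:
  "shuffle_prod vs f (\<lambda>ws. r * h ws) = r * shuffle_prod vs f h"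
  by (induction vs arbitrary: f h) (simp_all add: algebra_simps)

text \<open>Every shuffle distributes all arguments over the two factors, so the two signs multiply
  to that of the whole list: the parity involution respects the product. Associativity needs this
  when the first argument goes to the third factor and has to pass the other two.\<close>

lemma shuffle_prod_sign:
  "shuffle_prod vs (\<lambda>ws. (-1) ^ length ws * f ws) (\<lambda>ws. (-1) ^ length ws * h ws)
     = (-1) ^ length vs * shuffle_prod vs f h"
proof (induction vs arbitrary: f h)
  case (Cons v vs)
  have neg: "shuffle_prod vs (\<lambda>ws. - f' ws) h' = - shuffle_prod vs f' h'" for f' h'
    using shuffle_prod_scale_left[of vs "-1" f' h'] by simp
  have neg': "shuffle_prod vs f' (\<lambda>ws. - h' ws) = - shuffle_prod vs f' h'" for f' h'
    using shuffle_prod_scale_right[of vs f' "-1" h'] by simp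
  show ?case
    using Cons.IH[of "\<lambda>ws. (-1) ^ length ws * f ws" "\<lambda>ws. h (v # ws)"]
    by (simp add: Cons.IH neg neg' distrib_left)
qed simp

text \<open>One unfolding turns either side into three terms, according to which factor receives the
  first argument. They agree pairwise by induction, the third pair after
  \<open>shuffle_prod_sign\<close>.\<close>

lemma shuffle_prod_assoc:
  "shuffle_prod vs (\<lambda>ws. shuffle_prod ws f h) k = shuffle_prod vs f (\<lambda>ws. shuffle_prod ws h k)"
  by (induction vs arbitrary: f h k)
    (simp_all add: shuffle_prod_add_left shuffle_prod_add_right shuffle_prod_sign[symmetric])

text \<open>A constant, as a form of degree 0, is supported on the empty list, so only the shuffle
  with empty left block contributes.\<close>

lemma shuffle_prod_scalar:
  "shuffle_prod vs (\<lambda>ws. if ws = [] then r else 0) h = r * h vs"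
proof (induction vs arbitrary: h)
  case (Cons v vs)
  have zero: "shuffle_prod vs (\<lambda>ws. 0) h = 0" for h :: "'a list \<Rightarrow> real"
    by (induction vs arbitrary: h) simp_all
  have "(\<lambda>ws. (-1) ^ length ws * (if ws = [] then r else 0)) = (\<lambda>ws::'a list. if ws = [] then r else 0)"
    by auto
  then show ?case by (simp add: zero Cons.IH)
qed simp

lemma wedge_assoc: "wedge (wedge \<alpha> \<beta>) \<gamma> = wedge \<alpha> (wedge \<beta> \<gamma>)"
  by (intro ext) (simp add: wedge_eq_shuffle_prod[abs_def] shuffle_prod_assoc)

lemma wedge_add_left: "wedge (\<alpha> + \<beta>) \<gamma> = wedge \<alpha> \<gamma> + wedge \<beta> \<gamma>"
  by (intro ext) (simp add: wedge_eq_shuffle_prod plus_fun_def shuffle_prod_add_left)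

lemma wedge_add_right: "wedge \<alpha> (\<beta> + \<gamma>) = wedge \<alpha> \<beta> + wedge \<alpha> \<gamma>"
  by (intro ext) (simp add: wedge_eq_shuffle_prod plus_fun_def shuffle_prod_add_right)

section \<open>Sums of smooth functions\<close>

lemma continuous_map_update_Euclidean:
  assumes "x \<in> topspace (Euclidean_space n)" "i < n"
  shows "continuous_map euclidean (Euclidean_space n) (\<lambda>t. x(i := t))"
  using assms unfolding Euclidean_space_def
  by (auto simp: continuous_map_in_subtopology continuous_map_componentwise_UNIV )

text \<open>Functions are controlled only on \<open>V\<close>, while \<open>pderiv_at\<close> needs
  them on a whole interval of a coordinate line. Such an interval exists because moving a coordinate
  below \<open>n\<close> stays in \<open>Euclidean_space n\<close>, in which \<open>V\<close> is
  open.\<close>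

lemma eventually_update_in_openin:
  assumes V: "openin (Euclidean_space n) V" and x: "x \<in> V" and i: "i < n"
  shows "\<forall>\<^sub>F t in nhds (x i). x(i := t) \<in> V"
proof -
  have "x \<in> topspace (Euclidean_space n)"
    using V x openin_subset by blast
  from openin_continuous_map_preimage[OF continuous_map_update_Euclidean[OF this i] V]
  have "open {t. x(i := t) \<in> V}" by simp
  then show ?thesis
    using x by (auto simp: eventually_nhds)
qed

text \<open>The function \<open>w\<close> need only agree with the combination on \<open>V\<close>.
  The induction requires this freedom, since the partial derivatives of \<open>w\<close> are known
  to be the combined ones only at points of \<open>V\<close>.\<close>

lemma Ck_on_linear:
  assumes "openin (Euclidean_space n) V" "Ck_on n k V f" "Ck_on n k V h"
    and "\<And>x. x \<in> V \<Longrightarrow> w x = c * f x + d * h x"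
  shows "Ck_on n k V w"
  using assms(2-)
proof (induction k arbitrary: f h w)
  case 0
  have "continuous_map (subtopology (Euclidean_space n) V) euclidean (\<lambda>x. c * f x + d * h x)"
    using 0 by (auto intro!: continuous_map_add continuous_map_real_mult_left)
  then show ?case
    using 0 by (auto elim!: continuous_map_eq)
next
  case (Suc k)
  have cont: "continuous_map (subtopology (Euclidean_space n) V) euclidean w"
  proof -
    have "continuous_map (subtopology (Euclidean_space n) V) euclidean (\<lambda>x. c * f x + d * h x)"
      using Suc.prems by (auto intro!: continuous_map_add continuous_map_real_mult_left)
    then show ?thesis
      using Suc.prems by (auto elim!: continuous_map_eq)
  qed
  have deriv: "((\<lambda>t. w (x(i := t))) has_field_derivative c * pderiv_at i f x + d * pderiv_at i h x)
      (at (x i))" if i: "i < n" and x: "x \<in> V" for i x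
  proof -
    have "(\<lambda>t. f (x(i := t))) differentiable at (x i)" "(\<lambda>t. h (x(i := t))) differentiable at (x i)"
      using Suc.prems i x by auto
    then have "((\<lambda>t. c * f (x(i := t)) + d * h (x(i := t))) has_field_derivative
        c * pderiv_at i f x + d * pderiv_at i h x) (at (x i))"
      unfolding pderiv_at_def
      by (intro DERIV_add DERIV_cmult) (auto simp: DERIV_deriv_iff_real_differentiable)
    moreover have "\<forall>\<^sub>F t in nhds (x i). c * f (x(i := t)) + d * h (x(i := t)) = w (x(i := t))"
      using eventually_update_in_openin[OF assms(1) x i]
      by eventually_elim (rule Suc.prems(3)[symmetric])
    ultimately show ?thesis
      by (subst (asm) DERIV_cong_ev[OF refl _ refl]) auto
  qed
  have "Ck_on n k V (pderiv_at i w)" if i: "i < n" for i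
  proof (rule Suc.IH)
    show "Ck_on n k V (pderiv_at i f)" "Ck_on n k V (pderiv_at i h)"
      using Suc.prems i by auto
    show "pderiv_at i w x = c * pderiv_at i f x + d * pderiv_at i h x" if "x \<in> V" for x
      using DERIV_imp_deriv[OF deriv[OF i that]] by (simp add: pderiv_at_def)
  qed
  then show ?case
    using cont deriv by (auto simp: real_differentiable_def)
qed

lemma Ck_on_const: "Ck_on n k V (\<lambda>x. c)"
proof (induction k arbitrary: c)
  case (Suc k)
  have "pderiv_at i (\<lambda>x. c) = (\<lambda>x. 0)" for i
    by (auto simp: pderiv_at_def)
  then show ?case using Suc by simp
qed simp


section \<open>Rules for wedge products, module multiplication and signs\<close>

lemma wedge_zero_left [simp]: "wedge 0 \<beta> = 0"
  using wedge_add_left[of 0 0 \<beta>] by simp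

lemma wedge_zero_right [simp]: "wedge \<alpha> 0 = 0"
  using wedge_add_right[of \<alpha> 0 0] by simp

lemma wedge_diff_left: "wedge (\<alpha> - \<beta>) \<gamma> = wedge \<alpha> \<gamma> - wedge \<beta> \<gamma>"
  using wedge_add_left[of "\<alpha> - \<beta>" \<beta> \<gamma>] by simp

lemma wedge_diff_right: "wedge \<alpha> (\<beta> - \<gamma>) = wedge \<alpha> \<beta> - wedge \<alpha> \<gamma>"
  using wedge_add_right[of \<alpha> "\<beta> - \<gamma>" \<gamma>] by simp

lemma wedge_scalar: "wedge (\<lambda>p vs. if vs = [] then r else 0) \<beta> = (\<lambda>p vs. r * \<beta> p vs)"
  by (intro ext) (simp add: wedge_eq_shuffle_prod shuffle_prod_scalar)

lemma smul_add_left: "smul (\<alpha> + \<beta>) X = smul \<alpha> X + smul \<beta> X"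
  by (auto simp: smul_def wedge_add_left)

lemma smul_add_right: "smul \<alpha> (X + Y) = smul \<alpha> X + smul \<alpha> Y"
  by (auto simp: smul_def wedge_add_right)

lemma smul_zero_left [simp]: "smul 0 X = 0"
  by (auto simp: smul_def)

lemma smul_zero_right [simp]: "smul \<alpha> 0 = 0"
  by (auto simp: smul_def)

lemma smul_diff_left: "smul (\<alpha> - \<beta>) X = smul \<alpha> X - smul \<beta> X"
  by (auto simp: smul_def wedge_diff_left)

lemma smul_smul: "smul \<alpha> (smul \<beta> X) = smul (wedge \<alpha> \<beta>) X"
  by (auto simp: smul_def wedge_assoc)

lemma smul_scalar_minus_one: "smul (\<lambda>p vs. if vs = [] then -1 else 0) X = - X"
  by (intro ext) (simp add: smul_def wedge_scalar)

lemma msign_zero [simp]: "msign e 0 = 0"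
  by (simp add: msign_def)

lemma msign_add: "msign e (x + y) = msign e x + msign e y"
  by (simp add: msign_def)

lemma msign_diff: "msign e (x - y) = msign e x - msign e y"
  by (simp add: msign_def)

lemma msign_msign [simp]: "msign e (msign e x) = x"
  by (simp add: msign_def)

lemma smul_msign_left: "smul (msign e \<alpha>) X = msign e (smul \<alpha> X)"
  using smul_diff_left[of 0 \<alpha> X] by (simp add: msign_def)

section \<open>Direct sums and gradings\<close>

definition additive_subgroup :: "'x::ab_group_add set \<Rightarrow> bool" where
  "additive_subgroup A \<longleftrightarrow> 0 \<in> A \<and> (\<forall>x\<in>A. \<forall>y\<in>A. x - y \<in> A)"

lemma
  assumes "additive_subgroup A"
  shows subgroup_zero: "0 \<in> A"
    and subgroup_diff: "x \<in> A \<Longrightarrow> y \<in> A \<Longrightarrow> x - y \<in> A"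
    and subgroup_add: "x \<in> A \<Longrightarrow> y \<in> A \<Longrightarrow> x + y \<in> A"
    and subgroup_msign: "x \<in> A \<Longrightarrow> msign e x \<in> A"
proof -
  show zero: "0 \<in> A" and diff: "\<And>x y. x \<in> A \<Longrightarrow> y \<in> A \<Longrightarrow> x - y \<in> A"
    using assms by (auto simp: additive_subgroup_def)
  have neg: "- x \<in> A" if "x \<in> A" for x
    using diff[OF zero that] by simp
  show "x + y \<in> A" if "x \<in> A" "y \<in> A"
    using diff[OF that(1) neg[OF that(2)]] by simp
  show "msign e x \<in> A" if "x \<in> A"
    using that neg by (simp add: msign_def)
qed

text \<open>Additivity is relative to a set because projections, metrics and connections are
  unconstrained outside the modules on which they are given.\<close>

definition additive_on :: "'x::ab_group_add set \<Rightarrow> ('x \<Rightarrow> 'y::ab_group_add) \<Rightarrow> bool" where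
  "additive_on A f \<longleftrightarrow> (\<forall>x\<in>A. \<forall>y\<in>A. f (x + y) = f x + f y)"

lemma
  assumes "additive_on A f" "additive_subgroup A"
  shows additive_on_zero: "f 0 = 0"
    and additive_on_add: "x \<in> A \<Longrightarrow> y \<in> A \<Longrightarrow> f (x + y) = f x + f y"
    and additive_on_diff: "x \<in> A \<Longrightarrow> y \<in> A \<Longrightarrow> f (x - y) = f x - f y"
    and additive_on_msign: "x \<in> A \<Longrightarrow> f (msign e x) = msign e (f x)"
proof -
  show add: "\<And>x y. x \<in> A \<Longrightarrow> y \<in> A \<Longrightarrow> f (x + y) = f x + f y"
    using assms by (simp add: additive_on_def)
  have z: "0 \<in> A" using assms subgroup_zero by blast
  show zero: "f 0 = 0" using add[OF z z] by simp
  show diff: "f (x - y) = f x - f y" if "x \<in> A" "y \<in> A" for x y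
    using add[OF subgroup_diff[OF assms(2) that] that(2)] by simp
  show "f (msign e x) = msign e (f x)" if "x \<in> A"
    using diff[OF z that] by (simp add: msign_def zero)
qed

text \<open>Serves both the splitting into \<open>D\<close> and \<open>Dperp\<close> and the grading
  by parity. The projection onto the second summand is obtained by \<open>swap\<close>.\<close>

locale direct_decomposition =
  fixes E A B :: "'x::ab_group_add set"
  assumes direct: "direct_sum E A B"
    and subgroup_A: "additive_subgroup A"
    and subgroup_B: "additive_subgroup B"
begin

lemma proj_eqI:
  assumes "y \<in> A" "x - y \<in> B"
  shows "proj A B x = y"
  unfolding proj_def
proof (rule the_equality)
  fix y' assume y': "y' \<in> A \<and> x - y' \<in> B"
  then have "y' - y \<in> A"
    using assms subgroup_A by (simp add: subgroup_diff)
  moreover have "(x - y) - (x - y') \<in> B"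
    using assms y' subgroup_B by (simp only: subgroup_diff)
  ultimately have "y' - y \<in> A \<inter> B" by simp
  then have "y' - y \<in> {0}"
    using direct unfolding direct_sum_def by (simp only:)
  then show "y' = y" by simp
qed (use assms in simp)

lemma mem_iff: "x \<in> E \<longleftrightarrow> (\<exists>y\<in>A. \<exists>z\<in>B. x = y + z)"
  using direct by (auto simp: direct_sum_def)

lemma decompose:
  assumes "x \<in> E"
  obtains y z where "y \<in> A" "z \<in> B" "x = y + z"
  using assms mem_iff by blast

lemma A_subset: "x \<in> A \<Longrightarrow> x \<in> E"
  using mem_iff subgroup_zero[OF subgroup_B] by force

lemma B_subset: "x \<in> B \<Longrightarrow> x \<in> E"
  using mem_iff subgroup_zero[OF subgroup_A] by force

lemma proj_add_eq: "y \<in> A \<Longrightarrow> z \<in> B \<Longrightarrow> proj A B (y + z) = y"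
  by (rule proj_eqI) auto

lemma proj_id: "y \<in> A \<Longrightarrow> proj A B y = y"
  by (rule proj_eqI) (auto simp: subgroup_zero[OF subgroup_B])

lemma proj_zero: "z \<in> B \<Longrightarrow> proj A B z = 0"
  by (rule proj_eqI) (auto simp: subgroup_zero[OF subgroup_A])

lemma proj_mem: "x \<in> E \<Longrightarrow> proj A B x \<in> A"
  by (erule decompose) (simp add: proj_add_eq)

lemma subgroup_E: "additive_subgroup E"
  unfolding additive_subgroup_def
proof (intro conjI ballI)
  show "0 \<in> E" by (simp add: A_subset subgroup_zero[OF subgroup_A])
next
  fix x x' assume "x \<in> E" "x' \<in> E"
  then obtain y z y' z' where *: "y \<in> A" "z \<in> B" "x = y + z" "y' \<in> A" "z' \<in> B" "x' = y' + z'"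
    by (metis decompose)
  then have "x - x' = (y - y') + (z - z')" by simp
  then show "x - x' \<in> E"
    using * mem_iff subgroup_A subgroup_B by (metis subgroup_diff)
qed

lemma additive_proj: "additive_on E (proj A B)"
  unfolding additive_on_def
proof (intro ballI)
  fix x x' assume "x \<in> E" "x' \<in> E"
  then obtain y z y' z' where *: "y \<in> A" "z \<in> B" "x = y + z" "y' \<in> A" "z' \<in> B" "x' = y' + z'"
    by (metis decompose)
  then have eq: "x + x' = (y + y') + (z + z')" by simp
  have "proj A B ((y + y') + (z + z')) = y + y'"
    using * subgroup_A subgroup_B by (intro proj_add_eq) (simp_all add: subgroup_add)
  then show "proj A B (x + x') = proj A B x + proj A B x'"
    unfolding eq using * by (simp add: proj_add_eq)
qed

lemma swap: "direct_decomposition E B A"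
proof
  show "direct_sum E B A"
    using direct unfolding direct_sum_def by (auto simp: Int_commute) (metis add.commute)+
qed (rule subgroup_A subgroup_B)+

lemma proj_add_proj: "x \<in> E \<Longrightarrow> proj A B x + proj B A x = x"
  by (erule decompose)
    (metis add.commute proj_add_eq direct_decomposition.proj_add_eq[OF swap])

end

locale graded_group =
  fixes E :: "'x::ab_group_add set" and A :: "bit \<Rightarrow> 'x set"
  assumes graded: "direct_sum E (A 0) (A 1)"
    and subgroups: "additive_subgroup (A e)"
begin

text \<open>In \<open>bit\<close> the parity opposite to \<open>e\<close> is \<open>e + 1\<close>,
  so \<open>e = 1\<close> is the swapped form of \<open>e = 0\<close>.\<close>

lemma decomposition: "direct_decomposition E (A e) (A (e + 1))"
proof -
  have "direct_decomposition E (A 0) (A 1)"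
    by unfold_locales (rule graded subgroups)+
  then show ?thesis
    by (cases e) (auto dest: direct_decomposition.swap)
qed

lemma hom_mem: "x \<in> A e \<Longrightarrow> x \<in> E"
  by (rule direct_decomposition.A_subset[OF decomposition])

lemma subgroup: "additive_subgroup E"
  by (rule direct_decomposition.subgroup_E[OF decomposition])

lemma additive_hom_part: "additive_on E (hom_part A e)"
  unfolding hom_part_def by (rule direct_decomposition.additive_proj[OF decomposition])

lemma hom_part_mem: "x \<in> E \<Longrightarrow> hom_part A e x \<in> A e"
  unfolding hom_part_def by (rule direct_decomposition.proj_mem[OF decomposition])

lemma hom_part_hom:
  assumes "x \<in> A e"
  shows "hom_part A e' x = (if e' = e then x else 0)"
proof (cases "e' = e")
  case True
  then show ?thesis
    using assms direct_decomposition.proj_id[OF decomposition] by (simp add: hom_part_def)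
next
  case False
  then have "e = e' + 1" by (cases e; cases e') auto
  then show ?thesis
    using False assms direct_decomposition.proj_zero[OF decomposition[of e']]
    by (simp add: hom_part_def)
qed

lemma hom_decompose:
  assumes "x \<in> E"
  obtains y z where "y \<in> A 0" "z \<in> A 1" "x = y + z"
  using direct_decomposition.decompose[OF decomposition[of 0] assms] by auto

end

lemma sum_bit: "(\<Sum>e\<in>{0, 1::bit}. f e) = f 0 + f 1"
  by simp

text \<open>The component of wrong parity is 0, so three of the four summands vanish. Vanishing of
  \<open>F\<close> is asked only at the given \<open>x\<close> and \<open>y\<close>, because
  formulas built from a connection are additive only on \<open>Der M\<close>.\<close>

lemma biextend_hom:
  assumes "graded_group E A" "graded_group E' B" "x \<in> A a" "y \<in> B b"
    and "\<And>a b. F a b 0 y = 0" "\<And>a b. F a b x 0 = 0" "\<And>a b. F a b 0 0 = 0"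
  shows "biextend A B F x y = F a b x y"
  using assms(5-) unfolding biextend_def sum_bit
  by (cases a; cases b)
    (simp_all add: graded_group.hom_part_hom[OF assms(1,3)] graded_group.hom_part_hom[OF assms(2,4)])

section \<open>Forms and derivations\<close>

locale smooth_mfd =
  fixes M :: "'m::{t2_space,second_countable_topology} manifold"
  assumes smooth: "smooth_manifold M"
begin

lemma smooth_funs_linear:
  assumes "f \<in> smooth_funs M" "h \<in> smooth_funs M"
  shows "(\<lambda>p. r * f p + s * h p) \<in> smooth_funs M"
  unfolding smooth_funs_def smooth_on_def
proof (clarify)
  fix W \<phi> k assume W: "(W, \<phi>) \<in> atlas M"
  then have "openin (Euclidean_space (mdim M)) (\<phi> ` W)"
    using smooth by (auto simp: smooth_manifold_def)
  moreover have "Ck_on (mdim M) k (\<phi> ` W) (\<lambda>x. f (inv_into W \<phi> x))"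
    "Ck_on (mdim M) k (\<phi> ` W) (\<lambda>x. h (inv_into W \<phi> x))"
    using assms W by (auto simp: smooth_funs_def smooth_on_def)
  ultimately show "Ck_on (mdim M) k (\<phi> ` W) (\<lambda>x. r * f (inv_into W \<phi> x) + s * h (inv_into W \<phi> x))"
    by (rule Ck_on_linear) simp
qed

lemma smooth_funs_const: "(\<lambda>p. r) \<in> smooth_funs M"
  by (auto simp: smooth_funs_def smooth_on_def Ck_on_const)

lemma forms_linear:
  assumes "\<alpha> \<in> forms M" "\<beta> \<in> forms M"
  shows "(\<lambda>p vs. r * \<alpha> p vs + s * \<beta> p vs) \<in> forms M"
proof -
  obtain N N' where "\<And>p vs. length vs > N \<Longrightarrow> \<alpha> p vs = 0" "\<And>p vs. length vs > N' \<Longrightarrow> \<beta> p vs = 0"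
    using assms unfolding forms_def by blast
  then have "\<exists>N. \<forall>p vs. length vs > N \<longrightarrow> r * \<alpha> p vs + s * \<beta> p vs = 0"
    by (intro exI[of _ "max N N'"]) simp
  moreover have "alternating_multilinear (tangent_space M p) (\<lambda>vs. r * \<alpha> p vs + s * \<beta> p vs)" for p
  proof -
    have "alternating_multilinear (tangent_space M p) (\<alpha> p)"
      "alternating_multilinear (tangent_space M p) (\<beta> p)"
      using assms by (auto simp: forms_def)
    then show ?thesis
      unfolding alternating_multilinear_def by (simp add: algebra_simps)
  qed
  ultimately show ?thesis
    using assms by (auto simp: forms_def intro!: smooth_funs_linear)
qed

lemma forms_zero: "0 \<in> forms M"
  by (auto simp: forms_def alternating_multilinear_def smooth_funs_const)

lemma scalar_form: "(\<lambda>p vs. if vs = [] then r else 0) \<in> forms M"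
proof -
  have "(\<lambda>p. if map (\<lambda>V. V p) Vs = [] then r else 0) \<in> smooth_funs M" for Vs :: "('m \<Rightarrow> 'm tvec) list"
    by (simp add: smooth_funs_const)
  then show ?thesis
    by (auto simp: forms_def alternating_multilinear_def intro!: exI[of _ 0])
qed

text \<open>Provides the even and odd components of a form. The condition on the length is
  independent of the point and unaffected by replacing an entry, so it disturbs neither smoothness
  nor multilinearity.\<close>

lemma parity_part_form:
  assumes "\<alpha> \<in> forms M"
  shows "(\<lambda>p vs. if of_nat (length vs) = e then \<alpha> p vs else 0) \<in> forms_hom M e"
proof -
  have "(\<lambda>p. if of_nat (length (map (\<lambda>V. V p) Vs)) = e then \<alpha> p (map (\<lambda>V. V p) Vs) else 0)
      \<in> smooth_funs M" if "set Vs \<subseteq> vector_fields M" for Vs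
    using assms that by (cases "of_nat (length Vs) = e") (auto simp: forms_def smooth_funs_const)
  moreover have "\<exists>N. \<forall>p vs. length vs > N \<longrightarrow> (if of_nat (length vs) = e then \<alpha> p vs else 0) = 0"
  proof -
    obtain N where "\<forall>p vs. length vs > N \<longrightarrow> \<alpha> p vs = 0"
      using assms unfolding forms_def by blast
    then show ?thesis by (intro exI[of _ N]) simp
  qed
  moreover have "alternating_multilinear (tangent_space M p)
      (\<lambda>vs. if of_nat (length vs) = e then \<alpha> p vs else 0)" for p
  proof -
    have "alternating_multilinear (tangent_space M p) (\<alpha> p)"
      using assms by (auto simp: forms_def)
    then show ?thesis
      unfolding alternating_multilinear_def by simp
  qed
  ultimately show ?thesis
    by (simp add: forms_hom_def forms_def)
qed

lemma forms_hom_linear: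
  "\<alpha> \<in> forms_hom M e \<Longrightarrow> \<beta> \<in> forms_hom M e \<Longrightarrow> (\<lambda>p vs. r * \<alpha> p vs + s * \<beta> p vs) \<in> forms_hom M e"
  by (auto simp: forms_hom_def intro: forms_linear)

lemma subgroup_forms_hom: "additive_subgroup (forms_hom M e)"
  unfolding additive_subgroup_def
proof (intro conjI ballI)
  show "0 \<in> forms_hom M e" by (auto simp: forms_hom_def forms_zero)
  show "\<alpha> - \<beta> \<in> forms_hom M e" if "\<alpha> \<in> forms_hom M e" "\<beta> \<in> forms_hom M e" for \<alpha> \<beta>
    using forms_hom_linear[OF that, of 1 "-1"] by (simp add: fun_diff_def)
qed

sublocale forms: graded_group "forms M" "forms_hom M"
proof
  show "direct_sum (forms M) (forms_hom M 0) (forms_hom M 1)"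
    unfolding direct_sum_def
  proof (intro conjI subset_antisym subsetI)
    fix \<alpha> assume \<alpha>: "\<alpha> \<in> forms M"
    have parity: "x = (if e = 0 then x else 0) + (if e = 1 then x else 0)" for x :: real and e :: bit
      by (cases e) simp_all
    have "\<alpha> = (\<lambda>p vs. if of_nat (length vs) = (0::bit) then \<alpha> p vs else 0) +
        (\<lambda>p vs. if of_nat (length vs) = (1::bit) then \<alpha> p vs else 0)"
      by (intro ext) (simp only: plus_fun_def parity[symmetric])
    then show "\<alpha> \<in> {x + y |x y. x \<in> forms_hom M 0 \<and> y \<in> forms_hom M 1}"
      using parity_part_form[OF \<alpha>] by blast
  next
    fix \<alpha> assume "\<alpha> \<in> {x + y |x y. x \<in> forms_hom M 0 \<and> y \<in> forms_hom M 1}"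
    then obtain x y where xy: "\<alpha> = x + y" "x \<in> forms M" "y \<in> forms M"
      by (auto simp: forms_hom_def)
    show "\<alpha> \<in> forms M"
      using forms_linear[OF xy(2,3), of 1 1] by (simp add: xy(1) plus_fun_def)
  next
    fix \<alpha> assume \<alpha>: "\<alpha> \<in> forms_hom M 0 \<inter> forms_hom M 1"
    have "\<alpha> p vs = 0" for p vs
      using \<alpha> by (cases "(of_nat (length vs) :: bit) = 0")
        (auto simp: forms_hom_def simp del: bit_not_zero_iff bit_not_one_iff)
    then show "\<alpha> \<in> {0}" by (auto simp: fun_eq_iff)
  next
    show "\<alpha> \<in> forms_hom M 0 \<inter> forms_hom M 1" if "\<alpha> \<in> {0}" for \<alpha>
      using that by (simp add: subgroup_zero[OF subgroup_forms_hom])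
  qed
qed (rule subgroup_forms_hom)

section \<open>The grading of derivations\<close>

lemma subgroup_Der_hom: "additive_subgroup (Der_hom M e)"
  unfolding additive_subgroup_def
proof (intro conjI ballI)
  show "0 \<in> Der_hom M e"
    by (auto simp: Der_hom_def subgroup_zero[OF subgroup_forms_hom] fun_eq_iff)
next
  fix X Y assume X: "X \<in> Der_hom M e" and Y: "Y \<in> Der_hom M e"
  show "X - Y \<in> Der_hom M e"
    unfolding Der_hom_def
  proof (intro CollectI conjI allI ballI impI)
    show "(X - Y) \<alpha> \<in> forms_hom M (e + b)" if "\<alpha> \<in> forms_hom M b" for b \<alpha>
      using X Y that by (simp add: Der_hom_def subgroup_diff[OF subgroup_forms_hom])
  next
    fix \<alpha> \<beta> r s assume "\<alpha> \<in> forms M" "\<beta> \<in> forms M"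
    then show "(X - Y) (\<lambda>p vs. r * \<alpha> p vs + s * \<beta> p vs) =
        (\<lambda>p vs. r * (X - Y) \<alpha> p vs + s * (X - Y) \<beta> p vs)"
      using X Y by (auto simp: Der_hom_def fun_eq_iff algebra_simps)
  next
    fix b \<alpha> \<beta> assume "\<alpha> \<in> forms_hom M b" "\<beta> \<in> forms M"
    then have "X (wedge \<alpha> \<beta>) = wedge (X \<alpha>) \<beta> + msign (e * b) (wedge \<alpha> (X \<beta>))"
      "Y (wedge \<alpha> \<beta>) = wedge (Y \<alpha>) \<beta> + msign (e * b) (wedge \<alpha> (Y \<beta>))"
      using X Y unfolding Der_hom_def by blast+
    then show "(X - Y) (wedge \<alpha> \<beta>) = wedge ((X - Y) \<alpha>) \<beta> + msign (e * b) (wedge \<alpha> ((X - Y) \<beta>))"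
      by (simp add: wedge_diff_left wedge_diff_right msign_diff)
  next
    show "(X - Y) \<alpha> = 0" if "\<alpha> \<notin> forms M" for \<alpha>
      using X Y that by (simp add: Der_hom_def)
  qed
qed

text \<open>The point is that the sum is direct. A derivation that is even and odd sends homogeneous
  forms to forms of both parities, hence to 0; additivity extends this to all forms, and off the
  forms the value is 0 by convention.\<close>

sublocale Der: graded_group "Der M" "Der_hom M"
proof
  show "direct_sum (Der M) (Der_hom M 0) (Der_hom M 1)"
    unfolding direct_sum_def
  proof (intro conjI subset_antisym[of "_ \<inter> _"] subsetI)
    fix X assume "X \<in> Der_hom M 0 \<inter> Der_hom M 1"
    then have X0: "X \<in> Der_hom M 0" and X1: "X \<in> Der_hom M 1" by auto
    have hom: "X \<alpha> = 0" if "\<alpha> \<in> forms_hom M b" for \<alpha> b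
    proof -
      have "X \<alpha> \<in> forms_hom M (0 + b)" "X \<alpha> \<in> forms_hom M (1 + b)"
        using X0 X1 that unfolding Der_hom_def by blast+
      then have "X \<alpha> \<in> forms_hom M 0 \<inter> forms_hom M 1"
        by (cases b) auto
      then show ?thesis
        using forms.graded unfolding direct_sum_def by blast
    qed
    have "X \<alpha> = 0" for \<alpha>
    proof (cases "\<alpha> \<in> forms M")
      case True
      then obtain \<beta> \<gamma> where *: "\<beta> \<in> forms_hom M 0" "\<gamma> \<in> forms_hom M 1" "\<alpha> = \<beta> + \<gamma>"
        by (rule forms.hom_decompose)
      \<comment> \<open>\<open>Der_hom\<close> speaks of real linear combinations; the coefficients
        1 specialise this to additivity.\<close>
      then have "X (\<lambda>p vs. 1 * \<beta> p vs + 1 * \<gamma> p vs) = (\<lambda>p vs. 1 * X \<beta> p vs + 1 * X \<gamma> p vs)"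
        using X0 forms.hom_mem unfolding Der_hom_def by blast
      then have "X (\<beta> + \<gamma>) = X \<beta> + X \<gamma>"
        by (simp add: plus_fun_def)
      then show ?thesis
        by (simp add: *(3) hom[OF *(1)] hom[OF *(2)])
    next
      case False
      then show ?thesis using X0 by (simp add: Der_hom_def)
    qed
    then show "X \<in> {0}" by (simp add: fun_eq_iff)
  qed (auto simp: Der_def subgroup_zero[OF subgroup_Der_hom])
qed (rule subgroup_Der_hom)

text \<open>\<open>graded_submodule\<close> does not mention negatives; they arise as multiples by
  the constant form -1.\<close>

lemma subgroup_submodule:
  assumes "graded_submodule M S"
  shows "additive_subgroup S"
  unfolding additive_subgroup_def
proof (intro conjI ballI)
  show "0 \<in> S" using assms by (simp add: graded_submodule_def)
  fix X Y assume XY: "X \<in> S" "Y \<in> S"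
  then have "smul (\<lambda>p vs. if vs = [] then -1 else 0) Y \<in> S"
    using assms scalar_form by (simp add: graded_submodule_def)
  then have "X + - Y \<in> S"
    using assms XY unfolding smul_scalar_minus_one by (simp only: graded_submodule_def)
  then show "X - Y \<in> S" by simp
qed

text \<open>A parity decomposition inside \<open>S\<close> is also one in \<open>Der M\<close>,
  where it is unique.\<close>

lemma hom_part_submodule:
  assumes "graded_submodule M S" "X \<in> S"
  shows "hom_part (Der_hom M) e X \<in> S"
proof -
  obtain Y Z where YZ: "Y \<in> S" "Z \<in> S" "Y \<in> Der_hom M 0" "Z \<in> Der_hom M 1" "X = Y + Z"
    using assms by (auto simp: graded_submodule_def)
  then have "hom_part (Der_hom M) e X = hom_part (Der_hom M) e Y + hom_part (Der_hom M) e Z"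
    using additive_on_add[OF Der.additive_hom_part Der.subgroup] Der.hom_mem by blast
  also have "\<dots> \<in> S"
    using YZ subgroup_submodule[OF assms(1)]
    by (simp add: Der.hom_part_hom subgroup_add subgroup_zero)
  finally show ?thesis .
qed

text \<open>This decides which component the term \<open>X . G(Y, U)\<close> of the semi-symmetric
  connection has: it stays in the summand that contains \<open>X\<close>.\<close>

lemma rmul_submodule:
  assumes "graded_submodule M S" "X \<in> S" "\<beta> \<in> forms M"
  shows "rmul M X \<beta> \<in> S"
proof -
  have "smul (hom_part (forms_hom M) b \<beta>) (hom_part (Der_hom M) a X) \<in> S" for a b
    using assms hom_part_submodule[OF assms(1,2)] forms.hom_mem[OF forms.hom_part_mem[OF assms(3)]]
    by (simp add: graded_submodule_def)
  then show ?thesis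
    unfolding rmul_def biextend_def sum_bit
    by (intro subgroup_add[OF subgroup_submodule[OF assms(1)]]
        subgroup_msign[OF subgroup_submodule[OF assms(1)]])
qed

lemma additive_rmul_left: "additive_on (Der M) (\<lambda>X. rmul M X \<beta>)"
  unfolding additive_on_def rmul_def biextend_def sum_bit
  by (simp add: additive_on_add[OF Der.additive_hom_part Der.subgroup] smul_add_right msign_add)

lemma additive_rmul_right: "additive_on (forms M) (rmul M X)"
  unfolding additive_on_def rmul_def biextend_def sum_bit
  by (simp add: additive_on_add[OF forms.additive_hom_part forms.subgroup] smul_add_left msign_add)

lemma rmul_hom:
  assumes "X \<in> Der_hom M a" "\<beta> \<in> forms_hom M b"
  shows "rmul M X \<beta> = msign (b * a) (smul \<beta> X)"
  unfolding rmul_def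
  by (rule biextend_hom[OF Der.graded_group_axioms forms.graded_group_axioms assms]) simp_all

end


section \<open>The Codazzi equation\<close>

locale semi_symmetric_splitting = smooth_mfd M
  for M :: "'m::{t2_space,second_countable_topology} manifold" +
  fixes g u :: bit
    and G GD GP :: "'m der \<Rightarrow> 'm der \<Rightarrow> 'm form"
    and nabL :: "'m der \<Rightarrow> 'm der \<Rightarrow> 'm der"
    and U :: "'m der"
    and D Dperp :: "'m der set"
  assumes metric: "graded_metric M (Der M) g G"
    and LC: "levi_civita M G nabL"
    and U_hom: "U \<in> Der_hom M u" and parity_U: "u + g = 0"
    and submodule_D: "graded_submodule M D" and submodule_P: "graded_submodule M Dperp"
    and split: "direct_sum (Der M) D Dperp"
    and metric_D: "graded_metric M D g GD" and metric_P: "graded_metric M Dperp g GP"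
    and G_split: "\<forall>X\<in>Der M. \<forall>Y\<in>Der M.
      G X Y = GD (proj D Dperp X) (proj D Dperp Y) + GP (proj Dperp D X) (proj Dperp D Y)"
begin

abbreviation "piD \<equiv> proj D Dperp"
abbreviation "piP \<equiv> proj Dperp D"
abbreviation "nab \<equiv> semi_symmetric M G U nabL"
abbreviation "nabD X Y \<equiv> piD (nab X Y)"
abbreviation "B X Y \<equiv> piP (nab X Y)"
abbreviation "nabP X \<xi> \<equiv> piP (nabL X \<xi>)"

section \<open>The two projections, their linearity over forms and their parity\<close>

sublocale DP: direct_decomposition "Der M" D Dperp
  by unfold_locales (rule split subgroup_submodule submodule_D submodule_P)+

sublocale PD: direct_decomposition "Der M" Dperp D
  by (rule DP.swap)

lemma U_Der: "U \<in> Der M"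
  using U_hom by (rule Der.hom_mem)

text \<open>Inherited from the two submodules through the splitting, with no computation with the
  Leibniz rule.\<close>

lemma smul_Der:
  assumes "\<alpha> \<in> forms M" "X \<in> Der M"
  shows "smul \<alpha> X \<in> Der M"
proof -
  obtain Y Z where "Y \<in> D" "Z \<in> Dperp" "X = Y + Z"
    using assms DP.decompose by blast
  then show ?thesis
    using assms submodule_D submodule_P DP.mem_iff
    by (metis graded_submodule_def smul_add_right)
qed

lemma piP_smul:
  assumes "\<alpha> \<in> forms M" "X \<in> Der M"
  shows "piP (smul \<alpha> X) = smul \<alpha> (piP X)"
proof -
  obtain Y Z where YZ: "Y \<in> Dperp" "Z \<in> D" "X = Y + Z"
    using assms PD.decompose by blast
  then have "smul \<alpha> Y \<in> Dperp" "smul \<alpha> Z \<in> D"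
    using assms submodule_D submodule_P by (simp_all add: graded_submodule_def)
  then show ?thesis
    using YZ by (simp add: smul_add_right PD.proj_add_eq)
qed

text \<open>Taking components of parity \<open>e\<close> in \<open>X = piD X + piP X\<close> gives
  another decomposition of \<open>X\<close> along the splitting, because both summands are graded.
  Uniqueness makes it the original one.\<close>

lemma proj_hom:
  assumes "X \<in> Der_hom M e"
  shows "piD X \<in> Der_hom M e" "piP X \<in> Der_hom M e"
proof -
  have X: "X \<in> Der M" using assms by (rule Der.hom_mem)
  let ?h = "hom_part (Der_hom M) e"
  have "piD X \<in> D" "piP X \<in> Dperp"
    using X by (rule DP.proj_mem PD.proj_mem)+
  then have h: "?h (piD X) \<in> D" "?h (piP X) \<in> Dperp" "piD X \<in> Der M" "piP X \<in> Der M"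
    using hom_part_submodule submodule_D submodule_P DP.A_subset DP.B_subset by blast+
  have "X = ?h (piD X + piP X)"
    using assms by (simp add: DP.proj_add_proj[OF X] Der.hom_part_hom)
  also have "\<dots> = ?h (piD X) + ?h (piP X)"
    using h by (intro additive_on_add[OF Der.additive_hom_part Der.subgroup])
  finally have X_eq: "X = ?h (piD X) + ?h (piP X)" .
  have "piD X = ?h (piD X)"
    using arg_cong[OF X_eq, of piD] h by (simp add: DP.proj_add_eq)
  then show "piD X \<in> Der_hom M e"
    using Der.hom_part_mem h by metis
  have "piP X = ?h (piP X)"
    using arg_cong[OF trans[OF X_eq add.commute], of piP] unfolding PD.proj_add_eq[OF h(2,1)] .
  then show "piP X \<in> Der_hom M e"
    using Der.hom_part_mem h by metis
qed

section \<open>The metric and orthogonality\<close>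

lemma additive_G_left: "Y \<in> Der M \<Longrightarrow> additive_on (Der M) (\<lambda>X. G X Y)"
  and additive_G_right: "X \<in> Der M \<Longrightarrow> additive_on (Der M) (G X)"
  using metric by (auto simp: graded_metric_def biadditive_on_def additive_on_def)

lemma G_hom:
  assumes "X \<in> Der_hom M a" "Y \<in> Der_hom M b"
  shows "G X Y \<in> forms_hom M (a + b + g)" "G X Y = msign (a * b) (G Y X)"
  using metric[unfolded graded_metric_def, THEN conjunct1, rule_format, of X a Y b]
    Der.hom_mem[OF assms(1)] Der.hom_mem[OF assms(2)] assms by blast+

text \<open>The parities of \<open>U\<close> and \<open>G\<close> cancel, so pairing with
  \<open>U\<close> preserves parity. Hence no sign in the Codazzi equation involves \<open>u\<close>
  or \<open>g\<close>.\<close>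

lemma G_U_hom:
  assumes "X \<in> Der_hom M a"
  shows "G X U \<in> forms_hom M a"
  using G_hom(1)[OF assms U_hom] by (simp only: add.assoc parity_U add_0_right)

lemma G_smul:
  assumes "\<alpha> \<in> forms_hom M b" "X \<in> Der_hom M a" "Y \<in> Der M"
  shows "G (smul \<alpha> X) Y = wedge \<alpha> (G X Y)"
  using metric[unfolded graded_metric_def, THEN conjunct2, THEN conjunct2, THEN conjunct1,
      rule_format, of \<alpha> b X a Y] assms Der.hom_mem by simp

lemma G_forms:
  assumes "X \<in> Der M" "Y \<in> Der M"
  shows "G X Y \<in> forms M"
proof -
  have hom: "G X' Y \<in> forms M" if X': "X' \<in> Der_hom M a" for a X'
  proof -
    obtain Y0 Y1 where Y: "Y0 \<in> Der_hom M 0" "Y1 \<in> Der_hom M 1" "Y = Y0 + Y1"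
      using assms(2) by (rule Der.hom_decompose)
    have "G X' Y = G X' Y0 + G X' Y1"
      unfolding Y(3) using X' Y
      by (intro additive_on_add[OF additive_G_right Der.subgroup]) (auto intro: Der.hom_mem)
    also have "\<dots> \<in> forms M"
      using G_hom(1)[OF X'] Y by (auto intro!: subgroup_add[OF forms.subgroup] intro: forms.hom_mem)
    finally show ?thesis .
  qed
  obtain X0 X1 where X: "X0 \<in> Der_hom M 0" "X1 \<in> Der_hom M 1" "X = X0 + X1"
    using assms(1) by (rule Der.hom_decompose)
  have "G X Y = G X0 Y + G X1 Y"
    unfolding X(3) using X assms(2)
    by (intro additive_on_add[OF additive_G_left Der.subgroup]) (auto intro: Der.hom_mem)
  also have "\<dots> \<in> forms M"
    using hom X by (auto intro!: subgroup_add[OF forms.subgroup])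
  finally show ?thesis .
qed

text \<open>In each summand of \<open>G_split\<close> one of the projected arguments is 0.\<close>

lemma G_orthogonal:
  assumes "X \<in> D" "\<xi> \<in> Dperp"
  shows "G X \<xi> = 0" "G \<xi> X = 0"
proof -
  have additive: "additive_on D (GD X)" "additive_on D (\<lambda>Y. GD Y X)"
    "additive_on Dperp (GP \<xi>)" "additive_on Dperp (\<lambda>\<eta>. GP \<eta> \<xi>)"
    using metric_D metric_P assms
    by (auto simp: graded_metric_def biadditive_on_def additive_on_def)
  have "GD X 0 = 0" "GD 0 X = 0" "GP \<xi> 0 = 0" "GP 0 \<xi> = 0"
    using additive[THEN additive_on_zero] DP.subgroup_A DP.subgroup_B by blast+
  moreover have "piD X = X" "piD \<xi> = 0" "piP X = 0" "piP \<xi> = \<xi>" "X \<in> Der M" "\<xi> \<in> Der M"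
    using assms DP.proj_id DP.proj_zero PD.proj_id PD.proj_zero DP.A_subset DP.B_subset by blast+
  ultimately show "G X \<xi> = 0" "G \<xi> X = 0"
    using G_split by simp_all
qed

section \<open>The Levi-Civita and the semi-symmetric connection on all derivations\<close>

lemma connection: "graded_connection M nabL"
  using LC by (simp add: levi_civita_def)

lemma additive_nabL_left: "Y \<in> Der M \<Longrightarrow> additive_on (Der M) (\<lambda>X. nabL X Y)"
  and additive_nabL_right: "X \<in> Der M \<Longrightarrow> additive_on (Der M) (nabL X)"
  using connection by (auto simp: graded_connection_def biadditive_on_def additive_on_def)

lemma nabL_hom: "X \<in> Der_hom M a \<Longrightarrow> Y \<in> Der_hom M b \<Longrightarrow> nabL X Y \<in> Der_hom M (a + b)"
  using connection by (simp add: graded_connection_def)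

lemma nabL_Der:
  assumes "X \<in> Der M" "Y \<in> Der M"
  shows "nabL X Y \<in> Der M"
proof -
  have hom: "nabL X' Y \<in> Der M" if X': "X' \<in> Der_hom M a" for a X'
  proof -
    obtain Y0 Y1 where Y: "Y0 \<in> Der_hom M 0" "Y1 \<in> Der_hom M 1" "Y = Y0 + Y1"
      using assms(2) by (rule Der.hom_decompose)
    have "nabL X' Y = nabL X' Y0 + nabL X' Y1"
      unfolding Y(3) using X' Y
      by (intro additive_on_add[OF additive_nabL_right Der.subgroup]) (auto intro: Der.hom_mem)
    also have "\<dots> \<in> Der M"
      using nabL_hom[OF X'] Y by (auto intro!: subgroup_add[OF Der.subgroup] intro: Der.hom_mem)
    finally show ?thesis .
  qed
  obtain X0 X1 where X: "X0 \<in> Der_hom M 0" "X1 \<in> Der_hom M 1" "X = X0 + X1"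
    using assms(1) by (rule Der.hom_decompose)
  have "nabL X Y = nabL X0 Y + nabL X1 Y"
    unfolding X(3) using X assms(2)
    by (intro additive_on_add[OF additive_nabL_left Der.subgroup]) (auto intro: Der.hom_mem)
  also have "\<dots> \<in> Der M"
    using hom X by (auto intro!: subgroup_add[OF Der.subgroup])
  finally show ?thesis .
qed

lemma torsion_free:
  assumes "X \<in> Der_hom M a" "Y \<in> Der_hom M b"
  shows "nabL X Y - msign (a * b) (nabL Y X) = bracket M X Y"
  using LC assms by (simp add: levi_civita_def)

text \<open>Read off from torsion-freeness, since a connection preserves degree; compositions of
  derivations need not be examined.\<close>

lemma bracket_hom:
  assumes "X \<in> Der_hom M a" "Y \<in> Der_hom M b"
  shows "bracket M X Y \<in> Der_hom M (a + b)"
  unfolding torsion_free[OF assms, symmetric]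
  using nabL_hom[OF assms] nabL_hom[OF assms(2,1)]
  by (intro subgroup_diff[OF subgroup_Der_hom] subgroup_msign[OF subgroup_Der_hom])
    (simp_all only: add.commute[of b a])

lemma Der_submodule: "graded_submodule M (Der M)"
  unfolding graded_submodule_def
proof (intro conjI ballI)
  fix X assume "X \<in> Der M"
  then show "\<exists>Y\<in>Der M \<inter> Der_hom M 0. \<exists>Z\<in>Der M \<inter> Der_hom M 1. X = Y + Z"
    using Der.hom_mem by (elim Der.hom_decompose) blast
qed (simp_all add: smul_Der subgroup_zero[OF Der.subgroup] subgroup_add[OF Der.subgroup])

lemma rmul_Der: "X \<in> Der M \<Longrightarrow> \<beta> \<in> forms M \<Longrightarrow> rmul M X \<beta> \<in> Der M"
  by (rule rmul_submodule[OF Der_submodule])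

lemma nab_Der: "X \<in> Der M \<Longrightarrow> Y \<in> Der M \<Longrightarrow> nab X Y \<in> Der M"
  unfolding semi_symmetric_def
  by (intro subgroup_diff[OF Der.subgroup] subgroup_add[OF Der.subgroup]
      nabL_Der rmul_Der smul_Der G_forms U_Der)

lemma additive_nab_left:
  assumes Y: "Y \<in> Der M"
  shows "additive_on (Der M) (\<lambda>X. nab X Y)"
  unfolding additive_on_def semi_symmetric_def
  using additive_on_add[OF additive_nabL_left[OF Y] Der.subgroup]
    additive_on_add[OF additive_G_left[OF Y] Der.subgroup]
    additive_on_add[OF additive_rmul_left Der.subgroup]
  by (simp add: smul_add_left)

lemma additive_nab_right:
  assumes X: "X \<in> Der M"
  shows "additive_on (Der M) (nab X)"
  unfolding additive_on_def semi_symmetric_def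
  using additive_on_add[OF additive_nabL_right[OF X] Der.subgroup]
    additive_on_add[OF additive_G_right[OF X] Der.subgroup]
    additive_on_add[OF additive_G_left[OF U_Der] Der.subgroup]
    additive_on_add[OF additive_rmul_right forms.subgroup] G_forms[OF _ U_Der]
  by (simp add: smul_add_left)

section \<open>The second fundamental form and the torsion\<close>

lemma additive_piP_comp:
  assumes "additive_on (Der M) f" "\<And>X. X \<in> Der M \<Longrightarrow> f X \<in> Der M"
  shows "additive_on (Der M) (\<lambda>X. piP (f X))"
  using assms additive_on_add[OF PD.additive_proj Der.subgroup]
  by (simp add: additive_on_def)

lemma additive_B_left: "Y \<in> Der M \<Longrightarrow> additive_on (Der M) (\<lambda>X. B X Y)"
  by (intro additive_piP_comp additive_nab_left nab_Der)

lemma additive_B_right: "X \<in> Der M \<Longrightarrow> additive_on (Der M) (B X)"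
  by (intro additive_piP_comp additive_nab_right nab_Der)

lemmas piP_add = additive_on_add[OF PD.additive_proj Der.subgroup]
lemmas piP_diff = additive_on_diff[OF PD.additive_proj Der.subgroup]
lemmas piP_msign = additive_on_msign[OF PD.additive_proj Der.subgroup]

lemma piP_nab:
  assumes "X \<in> Der M" "Y \<in> Der M"
  shows "B X Y = piP (nabL X Y) + piP (rmul M X (G Y U)) - piP (smul (G X Y) U)"
  unfolding semi_symmetric_def using assms
  by (simp add: piP_add piP_diff subgroup_add[OF Der.subgroup] nabL_Der rmul_Der smul_Der G_forms U_Der)

text \<open>For \<open>X\<close> in \<open>D\<close> the term \<open>X . G(Y, U)\<close> stays in
  \<open>D\<close> and is projected away. \<open>Y\<close> is arbitrary, so that the formula also
  covers arguments in \<open>Dperp\<close>.\<close>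

lemma B_eq:
  assumes "X \<in> D" "Y \<in> Der M"
  shows "B X Y = piP (nabL X Y) - smul (G X Y) (piP U)"
proof -
  have X: "X \<in> Der M" using assms(1) by (rule DP.A_subset)
  have "rmul M X (G Y U) \<in> D"
    using assms by (intro rmul_submodule[OF submodule_D] G_forms U_Der)
  then show ?thesis
    using piP_nab[OF X assms(2)] by (simp add: PD.proj_zero piP_smul G_forms X assms(2) U_Der)
qed

lemma B_perp_right:
  assumes "X \<in> D" "\<xi> \<in> Dperp"
  shows "B X \<xi> = nabP X \<xi>"
  using B_eq[OF assms(1) DP.B_subset[OF assms(2)]] by (simp add: G_orthogonal[OF assms])

text \<open>Here the right multiple lies in \<open>Dperp\<close> and survives, while the term with
  \<open>U\<close> vanishes by orthogonality. This is the origin of the last term of the Codazzi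
  equation.\<close>

lemma B_perp_left:
  assumes "\<xi> \<in> Dperp" "Z \<in> D"
  shows "B \<xi> Z = piP (nabL \<xi> Z) + rmul M \<xi> (G Z U)"
proof -
  have "\<xi> \<in> Der M" "Z \<in> Der M"
    using assms DP.A_subset DP.B_subset by blast+
  moreover have "rmul M \<xi> (G Z U) \<in> Dperp"
    using assms calculation by (intro rmul_submodule[OF submodule_P] G_forms U_Der)
  ultimately show ?thesis
    using piP_nab by (simp add: PD.proj_id G_orthogonal[OF assms(2,1)] PD.proj_zero
        subgroup_zero[OF DP.subgroup_A])
qed

text \<open>Both terms of \<open>B_eq\<close> are linear over forms in the first slot: the first by
  the connection axiom, the second by \<open>G_smul\<close>, which asks for homogeneous
  \<open>\<alpha>\<close> and \<open>X\<close>.\<close>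

lemma B_smul_left:
  assumes "\<alpha> \<in> forms_hom M b" "X \<in> D" "X \<in> Der_hom M a" "Z \<in> Der M"
  shows "B (smul \<alpha> X) Z = smul \<alpha> (B X Z)"
proof -
  have \<alpha>: "\<alpha> \<in> forms M" using assms(1) by (rule forms.hom_mem)
  have X: "X \<in> Der M" using assms(3) by (rule Der.hom_mem)
  have \<alpha>X: "smul \<alpha> X \<in> D" using \<alpha> assms(2) submodule_D by (simp add: graded_submodule_def)
  have "nabL (smul \<alpha> X) Z = smul \<alpha> (nabL X Z)"
    using connection \<alpha> X assms(4) by (simp add: graded_connection_def)
  moreover have "smul \<alpha> (Y - Y') = smul \<alpha> Y - smul \<alpha> Y'" for Y Y'
    using smul_add_right[of \<alpha> "Y - Y'" Y'] by simp
  ultimately show ?thesis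
    using \<alpha> X assms
    by (simp add: B_eq \<alpha>X G_smul piP_smul nabL_Der smul_smul)
qed

text \<open>The terms with \<open>U\<close> cancel by graded symmetry of \<open>G\<close>. Of the
  right multiples, the first acquires the sign \<open>a * b\<close> when written as a left multiple,
  since \<open>G Y U\<close> has parity \<open>b\<close>; in the second this sign cancels the one in
  front.\<close>

lemma nab_torsion:
  assumes "X \<in> Der_hom M a" "Y \<in> Der_hom M b"
  shows "nab X Y - msign (a * b) (nab Y X) =
    bracket M X Y + msign (a * b) (smul (G Y U) X) - smul (G X U) Y"
  unfolding semi_symmetric_def torsion_free[OF assms, symmetric]
    rmul_hom[OF assms(1) G_U_hom[OF assms(2)]] rmul_hom[OF assms(2) G_U_hom[OF assms(1)]]
    G_hom(2)[OF assms]
  by (simp add: msign_add msign_diff smul_msign_left mult.commute)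

text \<open>The difference of the two \<open>B(\<nabla>\<^sup>D, \<cdot>)\<close> terms is where the torsion of \<open>\<nabla>\<close> enters; since \<open>B\<close> is
  linear over forms in its first slot, it produces the terms with \<open>G(X, U)\<close> and \<open>G(Y, U)\<close>.\<close>

lemma B_torsion:
  assumes "X \<in> D" "X \<in> Der_hom M a" "Y \<in> D" "Y \<in> Der_hom M b" and Z: "Z \<in> Der M"
  shows "B (nabD X Y) Z - msign (a * b) (B (nabD Y X) Z) =
    B (piD (bracket M X Y)) Z + msign (a * b) (smul (G Y U) (B X Z)) - smul (G X U) (B Y Z)"
proof -
  note piD_add = additive_on_add[OF DP.additive_proj Der.subgroup]
    and piD_diff = additive_on_diff[OF DP.additive_proj Der.subgroup]
    and piD_msign = additive_on_msign[OF DP.additive_proj Der.subgroup]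
    and B_add = additive_on_add[OF additive_B_left[OF Z] Der.subgroup]
    and B_diff = additive_on_diff[OF additive_B_left[OF Z] Der.subgroup]
    and B_msign = additive_on_msign[OF additive_B_left[OF Z] Der.subgroup]
    and closed = subgroup_add[OF Der.subgroup] subgroup_diff[OF Der.subgroup]
      subgroup_msign[OF Der.subgroup]
  have XY: "X \<in> Der M" "Y \<in> Der M"
    using assms by (auto intro: DP.A_subset)
  have br: "bracket M X Y \<in> Der M"
    using bracket_hom[OF assms(2,4)] by (rule Der.hom_mem)
  have smul: "smul (G Y U) X \<in> D" "smul (G X U) Y \<in> D"
    using submodule_D assms G_forms[OF _ U_Der] XY by (auto simp: graded_submodule_def)
  have smul': "smul (G Y U) X \<in> Der M" "smul (G X U) Y \<in> Der M"
    using smul by (auto intro: DP.A_subset)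
  have nabs: "nab X Y \<in> Der M" "nab Y X \<in> Der M" "nabD X Y \<in> Der M" "nabD Y X \<in> Der M"
    "piD (bracket M X Y) \<in> Der M"
    using XY br by (auto intro: nab_Der DP.A_subset[OF DP.proj_mem])
  have "nabD X Y - msign (a * b) (nabD Y X) = piD (nab X Y - msign (a * b) (nab Y X))"
    by (simp add: piD_diff piD_msign nabs closed)
  also have "\<dots> = piD (bracket M X Y) + msign (a * b) (smul (G Y U) X) - smul (G X U) Y"
    unfolding nab_torsion[OF assms(2,4)]
    by (simp add: piD_add piD_diff piD_msign smul' br closed DP.proj_id[OF smul(1)]
        DP.proj_id[OF smul(2)])
  finally have eq: "nabD X Y - msign (a * b) (nabD Y X) =
    piD (bracket M X Y) + msign (a * b) (smul (G Y U) X) - smul (G X U) Y" .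
  have "B (nabD X Y) Z - msign (a * b) (B (nabD Y X) Z) =
      B (nabD X Y - msign (a * b) (nabD Y X)) Z"
    by (simp add: B_diff B_msign nabs closed)
  also have "\<dots> = B (piD (bracket M X Y)) Z + msign (a * b) (B (smul (G Y U) X) Z)
      - B (smul (G X U) Y) Z"
    unfolding eq by (simp add: B_add B_diff B_msign nabs smul' closed)
  finally show ?thesis
    unfolding B_smul_left[OF G_U_hom[OF assms(4)] assms(1,2) Z]
      B_smul_left[OF G_U_hom[OF assms(2)] assms(3,4) Z] .
qed

section \<open>The normal component of the curvature\<close>

lemma piP_nab_nab:
  assumes "X \<in> D" "Y \<in> Der M" "Z \<in> Der M"
  shows "piP (nab X (nab Y Z)) = B X (nabD Y Z) + nabP X (B Y Z)"
proof -
  have "nab Y Z \<in> Der M" using assms by (intro nab_Der)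
  then have *: "nabD Y Z \<in> D" "B Y Z \<in> Dperp" "nabD Y Z + B Y Z = nab Y Z"
    by (auto intro: DP.proj_mem PD.proj_mem DP.proj_add_proj)
  have "piP (nab X (nab Y Z)) = B X (nabD Y Z + B Y Z)"
    unfolding *(3) ..
  also have "\<dots> = B X (nabD Y Z) + B X (B Y Z)"
    using assms * DP.A_subset DP.B_subset
    by (intro additive_on_add[OF additive_B_right Der.subgroup]) auto
  finally show ?thesis
    unfolding B_perp_right[OF assms(1) *(2)] .
qed

lemma piP_nab_bracket:
  assumes "X \<in> Der_hom M a" "Y \<in> Der_hom M b" "Z \<in> D" "Z \<in> Der_hom M c"
  shows "piP (nab (bracket M X Y) Z) = B (piD (bracket M X Y)) Z
    + piP (bracket M (piP (bracket M X Y)) Z)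
    + msign ((a + b) * c) (nabP Z (piP (bracket M X Y)))
    + rmul M (piP (bracket M X Y)) (G Z U)"
proof -
  define W where "W = bracket M X Y"
  have W: "W \<in> Der_hom M (a + b)"
    unfolding W_def using assms(1,2) by (rule bracket_hom)
  note WD = Der.hom_mem[OF W] and ZD = Der.hom_mem[OF assms(4)]
  note WP = proj_hom(2)[OF W]
  have "piP (nab W Z) = B (piD W + piP W) Z"
    unfolding DP.proj_add_proj[OF WD] ..
  also have "\<dots> = B (piD W) Z + B (piP W) Z"
    using WD DP.A_subset[OF DP.proj_mem] PD.A_subset[OF PD.proj_mem]
    by (intro additive_on_add[OF additive_B_left[OF ZD] Der.subgroup])
  finally have sum: "piP (nab W Z) = B (piD W) Z + B (piP W) Z" .
  have B_piP: "B (piP W) Z = piP (nabL (piP W) Z) + rmul M (piP W) (G Z U)"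
    using WD assms(3) by (intro B_perp_left PD.proj_mem)
  \<comment> \<open>The projection is even, so \<open>piP W\<close> still has parity
    \<open>a + b\<close>. Exchanging it with \<open>Z\<close> replaces a derivative in a normal
    direction by one along \<open>D\<close>, whose normal component is \<open>nabP\<close>.\<close>
  have nabL_piP: "nabL (piP W) Z = bracket M (piP W) Z + msign ((a + b) * c) (nabL Z (piP W))"
    unfolding torsion_free[OF WP assms(4), symmetric] by simp
  have "piP (nabL (piP W) Z) = piP (bracket M (piP W) Z) + msign ((a + b) * c) (nabP Z (piP W))"
    unfolding nabL_piP using bracket_hom[OF WP assms(4)] nabL_hom[OF assms(4) WP]
    by (simp only: piP_add piP_msign subgroup_msign[OF Der.subgroup] Der.hom_mem)
  then show ?thesis
    using sum B_piP unfolding W_def by (simp only: add.assoc)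
qed

lemma curvature_hom:
  assumes "X \<in> Der_hom M a" "Y \<in> Der_hom M b" "Z \<in> Der M"
  shows "curvature M nab X Y Z =
    nab X (nab Y Z) - msign (a * b) (nab Y (nab X Z)) - nab (bracket M X Y) Z"
proof -
  \<comment> \<open>These are the vanishing conditions of \<open>biextend_hom\<close>, which come
    down to additivity of \<open>nab\<close> in either slot.\<close>
  have zero: "nab 0 Z' = 0" "Z' \<in> Der M \<Longrightarrow> nab Z' 0 = 0" if "Z' \<in> Der M" for Z'
    using additive_on_zero[OF additive_nab_left[OF that] Der.subgroup]
      additive_on_zero[OF additive_nab_right[OF that] Der.subgroup] by simp_all
  show ?thesis
    unfolding curvature_def
    using assms Der.hom_mem[OF assms(1)] Der.hom_mem[OF assms(2)]
    by (subst biextend_hom[OF Der.graded_group_axioms Der.graded_group_axioms assms(1,2)])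
      (simp_all add: zero nab_Der subgroup_zero[OF Der.subgroup])
qed

lemma cov_deriv_B_hom:
  assumes "X \<in> Der_hom M a" "Y \<in> Der_hom M b" "Z \<in> Der M"
  shows "cov_deriv_B M (\<lambda>X Y. nabD X Y) (\<lambda>X \<xi>. nabP X \<xi>) (\<lambda>X Y. B X Y) X Y Z =
    nabP X (B Y Z) - B (nabD X Y) Z - msign (a * b) (B Y (nabD X Z))"
proof -
  have D0: "0 \<in> Der M" by (rule subgroup_zero[OF Der.subgroup])
  have zero: "nab 0 Z' = 0" "nab Z' 0 = 0" "nabL 0 Z' = 0" "nabL Z' 0 = 0" if "Z' \<in> Der M" for Z'
    using additive_on_zero[OF additive_nab_left[OF that] Der.subgroup]
      additive_on_zero[OF additive_nab_right[OF that] Der.subgroup]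
      additive_on_zero[OF additive_nabL_left[OF that] Der.subgroup]
      additive_on_zero[OF additive_nabL_right[OF that] Der.subgroup] by simp_all
  have proj: "piD 0 = 0" "piP 0 = 0"
    by (rule DP.proj_zero PD.proj_zero subgroup_zero[OF DP.subgroup_A] subgroup_zero[OF DP.subgroup_B])+
  have closed: "nabD X' Y' \<in> Der M" "B X' Y' \<in> Der M" if "X' \<in> Der M" "Y' \<in> Der M" for X' Y'
    using nab_Der[OF that] by (auto intro: DP.A_subset DP.B_subset DP.proj_mem PD.proj_mem)
  show ?thesis
    unfolding cov_deriv_B_def
    using assms Der.hom_mem[OF assms(1)] Der.hom_mem[OF assms(2)] D0
    by (subst biextend_hom[OF Der.graded_group_axioms Der.graded_group_axioms assms(1,2)])
      (simp_all add: zero proj closed)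
qed

lemma codazzi:
  assumes "X \<in> D" "X \<in> Der_hom M a" "Y \<in> D" "Y \<in> Der_hom M b" "Z \<in> D" "Z \<in> Der_hom M c"
  defines "cov \<equiv> cov_deriv_B M (\<lambda>X Y. nabD X Y) (\<lambda>X \<xi>. nabP X \<xi>) (\<lambda>X Y. B X Y)"
  shows "piP (curvature M nab X Y Z) =
      cov X Y Z - msign (a * b) (cov Y X Z)
      - smul (G X U) (B Y Z) + msign (a * b) (smul (G Y U) (B X Z))
      - piP (bracket M (piP (bracket M X Y)) Z)
      - msign ((a + b) * c) (nabP Z (piP (bracket M X Y)))
      - rmul M (piP (bracket M X Y)) (G Z U)"
proof -
  have Der: "X \<in> Der M" "Y \<in> Der M" "Z \<in> Der M" "bracket M X Y \<in> Der M"
    using assms(2,4,6) bracket_hom[OF assms(2,4)] by (blast intro: Der.hom_mem)+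
  have "piP (curvature M nab X Y Z) = piP (nab X (nab Y Z)) - msign (a * b) (piP (nab Y (nab X Z)))
      - piP (nab (bracket M X Y) Z)"
    unfolding curvature_hom[OF assms(2,4) Der(3)]
    by (simp add: piP_diff piP_msign nab_Der Der subgroup_diff[OF Der.subgroup]
        subgroup_msign[OF Der.subgroup])
  also have "\<dots> = B X (nabD Y Z) + nabP X (B Y Z)
      - msign (a * b) (B Y (nabD X Z) + nabP Y (B X Z)) - piP (nab (bracket M X Y) Z)"
    using assms Der by (simp add: piP_nab_nab)
  finally have curv: "piP (curvature M nab X Y Z) = B X (nabD Y Z) + nabP X (B Y Z)
      - msign (a * b) (B Y (nabD X Z) + nabP Y (B X Z)) - piP (nab (bracket M X Y) Z)" .
  \<comment> \<open>\<open>B_torsion\<close> is solved for the tangential part of the bracket, which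
    brings in the terms \<open>B (nabD X Y) Z\<close> and \<open>B (nabD Y X) Z\<close> of the two
    covariant derivatives.\<close>
  have B_bracket: "B (piD (bracket M X Y)) Z = B (nabD X Y) Z - msign (a * b) (B (nabD Y X) Z)
      - msign (a * b) (smul (G Y U) (B X Z)) + smul (G X U) (B Y Z)"
    using B_torsion[OF assms(1-4) Der(3)] by simp
  show ?thesis
    unfolding curv piP_nab_bracket[OF assms(2,4,5,6)] B_bracket cov_def
      cov_deriv_B_hom[OF assms(2,4) Der(3)] cov_deriv_B_hom[OF assms(4,2) Der(3)]
    \<comment> \<open>In the covariant derivative with \<open>X\<close> and \<open>Y\<close>
      exchanged the inner sign is \<open>b * a\<close>; once it is written \<open>a * b\<close> it
      cancels the outer one and leaves \<open>B X (nabD Y Z)\<close>.\<close>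
    by (simp add: msign_add msign_diff mult.commute[of b a])
qed

end

theorem theorem3p5:
  fixes M :: "'m::{t2_space,second_countable_topology} manifold"
    and g u a b c :: bit
    and G GD GP :: "'m der \<Rightarrow> 'm der \<Rightarrow> 'm form"
    and nabL nab nabD nabP B :: "'m der \<Rightarrow> 'm der \<Rightarrow> 'm der"
    and U X Y Z :: "'m der"
    and D Dperp :: "'m der set"
    and piD piP :: "'m der \<Rightarrow> 'm der"
  defines "piD \<equiv> proj D Dperp"
    and "piP \<equiv> proj Dperp D"
    and "nab \<equiv> semi_symmetric M G U nabL"
    and "nabD \<equiv> (\<lambda>X Y. piD (nab X Y))"
    and "B \<equiv> (\<lambda>X Y. piP (nab X Y))"
    and "nabP \<equiv> (\<lambda>X \<xi>. piP (nabL X \<xi>))"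
  assumes "smooth_manifold M"
    and "graded_metric M (Der M) g G"
    and "levi_civita M G nabL"
    and "U \<in> Der_hom M u" and "u + g = 0"
    and "graded_submodule M D" and "graded_submodule M Dperp"
    and "direct_sum (Der M) D Dperp"
    and "graded_metric M D g GD" and "graded_metric M Dperp g GP"
    and "\<forall>X\<in>Der M. \<forall>Y\<in>Der M. G X Y = GD (piD X) (piD Y) + GP (piP X) (piP Y)"
    and "X \<in> D \<inter> Der_hom M a" and "Y \<in> D \<inter> Der_hom M b" and "Z \<in> D \<inter> Der_hom M c"
  shows "piP (curvature M nab X Y Z) =
      cov_deriv_B M nabD nabP B X Y Z - msign (a * b) (cov_deriv_B M nabD nabP B Y X Z)
      - smul (G X U) (B Y Z) + msign (a * b) (smul (G Y U) (B X Z))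
      - piP (bracket M (piP (bracket M X Y)) Z)
      - msign ((a + b) * c) (nabP Z (piP (bracket M X Y)))
      - rmul M (piP (bracket M X Y)) (G Z U)"
proof -
  \<comment> \<open>The first six facts of \<open>assms\<close> are the defining equations; the last
    three, on \<open>X\<close>, \<open>Y\<close> and \<open>Z\<close>, are left for
    \<open>codazzi\<close>.\<close>
  interpret semi_symmetric_splitting M g u G GD GP nabL U D Dperp
    using assms(7-17) unfolding piD_def piP_def by unfold_locales
  show ?thesis
    unfolding piD_def piP_def nab_def nabD_def B_def nabP_def
    using assms(18-) by (intro codazzi) auto
qed

end
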